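(* Let $R=\{(0,0),(0,1),(2,0),(3,0),(2,1),(2,2),(3,1),(3,2)\}$ and $R'=\{(0,0),(0,2),(0,3),(1,0),(1,2),(1,3),(2,2),(2,3)\}$. Then $(123,R)\sim_{jd}(132,R)$ and $(123,R')\sim_{jd}(132,R')$. Moreover, both pairs $\{(123,R),(132,R)\}$ and $\{(123,R'),(132,R')\}$ have the same joint distribution as each of the twenty pairs $\{(123,Q),(132,Q)\}$ with $Q\in\{X_9,\dots,X_{18},Y_9,\dots,Y_{18}\}$, where for $9\le j\le 18$ we put $X_j=\{(0,0),(0,1),(0,2),(0,3)\}\cup S_j$, $Y_j=\{(y,x):(x,y)\in X_j\}$, and $S_9=\{(1,1),(1,2),(3,1),(3,2)\}$, $S_{10}=\{(1,2),(1,3),(3,2),(3,3)\}$, $S_{11}=\{(1,1),(1,3),(2,1),(2,3)\}$, $S_{12}=\{(2,1),(2,3),(3,1),(3,3)\}$, $S_{13}=\{(1,1),(1,2),(1,3),(3,2)\}$, $S_{14}=\{(1,2),(3,1),(3,2),(3,3)\}$, $S_{15}=\{(1,1),(2,1),(2,3),(3,1)\}$, $S_{16}=\{(1,3),(2,1),(2,3),(3,3)\}$, $S_{17}=\{(2,1),(2,2),(3,1),(3,2)\}$, $S_{18}=\{(1,2),(1,3),(2,2),(2,3)\}$.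
   Context: $S_n$ is the set of permutations $\pi=\pi_1\cdots\pi_n$ of $\{1,\dots,n\}$. A mesh pattern of length $k$ is a pair $(\tau,R)$ with $\tau\in S_k$ and $R\subseteq\{0,\dots,k\}\times\{0,\dots,k\}$ (the set of shaded boxes; box $(a,b)$ is the unit square with lower-left corner $(a,b)$). An occurrence of $(\tau,R)$ in $\pi\in S_n$ is a subsequence $\pi_{i_1}\cdots\pi_{i_k}$, $i_1<\dots<i_k$, order-isomorphic to $\tau$, such that, with $i_0=0$, $i_{k+1}=n+1$, with $v_1<\dots<v_k$ the values $\pi_{i_1},\dots,\pi_{i_k}$ in increasing order, and $v_0=0$, $v_{k+1}=n+1$, for each $(a,b)\in R$ there is no index $m$ with $i_a<m<i_{a+1}$ and $v_b<\pi_m<v_{b+1}$. Two mesh patterns $q_1,q_2$ are jointly equidistributed, written $q_1\sim_{jd}q_2$, if for all nonnegative integers $n,k,\ell$ the number of $\pi\in S_n$ with exactly $k$ occurrences of $q_1$ and $\ell$ occurrences of $q_2$ equals the number of $\pi\in S_n$ with exactly $\ell$ occurrences of $q_1$ and $k$ occurrences of $q_2$. The joint distribution of a pair $\{q_1,q_2\}$ (with $q_1$ having underlying permutation $123$ and $q_2$ having underlying permutation $132$) is the family of numbers $T_{n,k,\ell}$ of $\pi\in S_n$ with exactly $k$ occurrences of $q_1$ and $\ell$ occurrences of $q_2$; two pairs have the same joint distribution if these numbers agree for all $n,k,\ell$. *)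

theory Defs
  imports "HOL-Combinatorics.Permutations"
begin

text \<open>Permutations of \<open>{1..n}\<close> are functions \<open>\<pi>\<close> with \<open>\<pi> permutes {1..n}\<close>,
  the one-line notation being \<open>\<pi> 1, \<dots>, \<pi> n\<close>.
  A mesh pattern \<open>(k, \<tau>, R)\<close> has length \<open>k\<close>, underlying permutation \<open>\<tau>\<close>
  of \<open>{1..k}\<close> and shaded boxes \<open>R\<close>; the box \<open>(a, b)\<close> has lower-left corner
  \<open>(a, b)\<close>, so \<open>a\<close> refers to positions and \<open>b\<close> to values.\<close>

type_synonym mesh_pattern = "nat \<times> (nat \<Rightarrow> nat) \<times> (nat \<times> nat) set"

definition is_mesh_pattern :: "mesh_pattern \<Rightarrow> bool" where
  "is_mesh_pattern q \<longleftrightarrow> (case q of (k, \<tau>, R) \<Rightarrow>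
     \<tau> permutes {1..k} \<and> R \<subseteq> {0..k} \<times> {0..k})"

text \<open>An occurrence is represented by the increasing list \<open>ps\<close> of its positions.
  With the sentinels added, \<open>i 0 = 0\<close>, \<open>i 1, \<dots>, i k\<close> are these positions and
  \<open>i (k + 1) = n + 1\<close>; similarly \<open>v 1 < \<dots> < v k\<close> are the values of \<open>\<pi>\<close> there.\<close>

definition mesh_occurrences :: "mesh_pattern \<Rightarrow> nat \<Rightarrow> (nat \<Rightarrow> nat) \<Rightarrow> nat list set" where
  "mesh_occurrences q n \<pi> = (case q of (k, \<tau>, R) \<Rightarrow>
     {ps. length ps = k \<and> sorted_wrt (<) ps \<and> set ps \<subseteq> {1..n} \<and>
        (let i = (\<lambda>a. (0 # ps @ [n + 1]) ! a);
             v = (\<lambda>b. (0 # sort (map \<pi> ps) @ [n + 1]) ! b)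
         in (\<forall>a\<in>{1..k}. \<forall>b\<in>{1..k}. \<pi> (i a) < \<pi> (i b) \<longleftrightarrow> \<tau> a < \<tau> b) \<and>
            (\<forall>(a, b)\<in>R. \<not> (\<exists>m\<in>{1..n}. i a < m \<and> m < i (a + 1) \<and> v b < \<pi> m \<and> \<pi> m < v (b + 1))))})"

definition joint_distribution :: "mesh_pattern \<Rightarrow> mesh_pattern \<Rightarrow> nat \<Rightarrow> nat \<Rightarrow> nat \<Rightarrow> nat" where
  "joint_distribution q1 q2 n k l =
     card {\<pi>. \<pi> permutes {1..n} \<and>
       card (mesh_occurrences q1 n \<pi>) = k \<and> card (mesh_occurrences q2 n \<pi>) = l}"

definition jointly_equidistributed :: "mesh_pattern \<Rightarrow> mesh_pattern \<Rightarrow> bool"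
    (infix "\<sim>\<^sub>j\<^sub>d" 50) where
  "q1 \<sim>\<^sub>j\<^sub>d q2 \<longleftrightarrow>
     (\<forall>n k l. joint_distribution q1 q2 n k l = joint_distribution q1 q2 n l k)"

definition same_joint_distribution ::
    "mesh_pattern \<times> mesh_pattern \<Rightarrow> mesh_pattern \<times> mesh_pattern \<Rightarrow> bool" where
  "same_joint_distribution p p' \<longleftrightarrow>
     (\<forall>n k l. joint_distribution (fst p) (snd p) n k l = joint_distribution (fst p') (snd p') n k l)"

definition mesh123 :: "(nat \<times> nat) set \<Rightarrow> mesh_pattern" where
  "mesh123 R = (3, id, R)"

definition mesh132 :: "(nat \<times> nat) set \<Rightarrow> mesh_pattern" where
  "mesh132 R = (3, transpose 2 3, R)"

definition R_boxes :: "(nat \<times> nat) set" where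
  "R_boxes = {(0,0),(0,1),(2,0),(3,0),(2,1),(2,2),(3,1),(3,2)}"

definition R'_boxes :: "(nat \<times> nat) set" where
  "R'_boxes = {(0,0),(0,2),(0,3),(1,0),(1,2),(1,3),(2,2),(2,3)}"

text \<open>Only the indices \<open>9 \<le> j \<le> 18\<close> are meaningful.\<close>

definition S_boxes :: "nat \<Rightarrow> (nat \<times> nat) set" where
  "S_boxes j =
    (if j = 9 then {(1,1),(1,2),(3,1),(3,2)}
     else if j = 10 then {(1,2),(1,3),(3,2),(3,3)}
     else if j = 11 then {(1,1),(1,3),(2,1),(2,3)}
     else if j = 12 then {(2,1),(2,3),(3,1),(3,3)}
     else if j = 13 then {(1,1),(1,2),(1,3),(3,2)}
     else if j = 14 then {(1,2),(3,1),(3,2),(3,3)}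
     else if j = 15 then {(1,1),(2,1),(2,3),(3,1)}
     else if j = 16 then {(1,3),(2,1),(2,3),(3,3)}
     else if j = 17 then {(2,1),(2,2),(3,1),(3,2)}
     else if j = 18 then {(1,2),(1,3),(2,2),(2,3)}
     else {})"

definition X_boxes :: "nat \<Rightarrow> (nat \<times> nat) set" where
  "X_boxes j = {(0,0),(0,1),(0,2),(0,3)} \<union> S_boxes j"

definition Y_boxes :: "nat \<Rightarrow> (nat \<times> nat) set" where
  "Y_boxes j = {(y, x) | x y. (x, y) \<in> X_boxes j}"

lemma is_mesh_pattern_mesh123: "R \<subseteq> {0..3} \<times> {0..3} \<Longrightarrow> is_mesh_pattern (mesh123 R)"
  by (simp add: is_mesh_pattern_def mesh123_def permutes_id)

lemma is_mesh_pattern_mesh132: "R \<subseteq> {0..3} \<times> {0..3} \<Longrightarrow> is_mesh_pattern (mesh132 R)"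
  by (simp add: is_mesh_pattern_def mesh132_def permutes_swap_id)

lemma boxes_in_grid:
  "R_boxes \<subseteq> {0..3} \<times> {0..3}"
  "R'_boxes \<subseteq> {0..3} \<times> {0..3}"
  "X_boxes j \<subseteq> {0..3} \<times> {0..3}"
  "Y_boxes j \<subseteq> {0..3} \<times> {0..3}"
  by (auto simp: R_boxes_def R'_boxes_def X_boxes_def Y_boxes_def S_boxes_def split: if_splits)

end

theory Submission
  imports Defs
begin

text \<open>
  A permutation is identified with its set of points \<open>(i, \<pi> i)\<close>. The shading \<open>X_boxes j\<close> forces the first letter
  of an occurrence to be the leftmost point \<open>(x, y)\<close> of the permutation, and points below \<open>y\<close> become irrelevant;
  so occurrences correspond to occurrences of the length-two mesh patterns 12 and 21, with shading
  \<open>S_boxes j\<close> shifted by one, among the points above \<open>y\<close>. For \<open>R'_boxes\<close> the same points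
  above \<open>y\<close> appear, with the shading from \<open>S_boxes 18\<close>: the first letter of an occurrence is determined as the lowest
  point to the left of the second one, hence carries no information. \<open>R_boxes\<close> and \<open>Y_boxes j\<close> arise from these by
  inversion of permutations.

  It remains to see that for each of the ten length-two shadings the pair (12, 21) has the generating
  function \<open>\<Prod>i=2..m. (p + q + (i - 2))\<close> over permutations of size \<open>m\<close>, which is symmetric in \<open>p\<close> and \<open>q\<close>. Up to
  inversion and reversal there are three cases. In two of them removing the leftmost point multiplies
  the generating function by such a factor, since exactly one value of that point creates an
  occurrence of 12 and exactly one other value creates an occurrence of 21. In the third one the leftmost point is fixed and
  the points above and below it are counted separately.
\<close>

section \<open>Point sets of permutations\<close>

text \<open>These are the graphs of bijections from \<open>X\<close> to \<open>Y\<close>. Arbitrary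
  coordinate sets allow a point to be removed without renumbering the others, and integers make
  reversal a plain negation.\<close>

definition diagrams :: "int set \<Rightarrow> int set \<Rightarrow> (int \<times> int) set set" where
  "diagrams X Y = {P. P \<subseteq> X \<times> Y \<and> (\<forall>x\<in>X. \<exists>!y. (x, y) \<in> P) \<and> (\<forall>y\<in>Y. \<exists>!x. (x, y) \<in> P)}"

lemma diagrams_subset: "P \<in> diagrams X Y \<Longrightarrow> P \<subseteq> X \<times> Y"
  by (simp add: diagrams_def)

lemma diagrams_fst_inj:
  assumes "P \<in> diagrams X Y" "p \<in> P" "q \<in> P" "fst p = fst q"
  shows "p = q"
proof -
  have "fst p \<in> X" using diagrams_subset[OF assms(1)] assms(2) by auto
  then have "\<exists>!y. (fst p, y) \<in> P" using assms(1) by (simp add: diagrams_def)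
  moreover have "(fst p, snd p) \<in> P" using assms(2) by simp
  moreover have "(fst p, snd q) \<in> P" using assms(3) by (simp add: assms(4))
  ultimately have "snd p = snd q" by blast
  then show ?thesis using assms(4) by (simp add: prod_eq_iff)
qed

lemma diagrams_snd_inj:
  assumes "P \<in> diagrams X Y" "p \<in> P" "q \<in> P" "snd p = snd q"
  shows "p = q"
proof -
  have "snd p \<in> Y" using diagrams_subset[OF assms(1)] assms(2) by auto
  then have "\<exists>!x. (x, snd p) \<in> P" using assms(1) by (simp add: diagrams_def)
  moreover have "(fst p, snd p) \<in> P" using assms(2) by simp
  moreover have "(fst q, snd p) \<in> P" using assms(3) by (simp add: assms(4))
  ultimately have "fst p = fst q" by blast
  then show ?thesis using assms(4) by (simp add: prod_eq_iff)
qed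

lemma finite_diagrams: "finite X \<Longrightarrow> finite Y \<Longrightarrow> finite (diagrams X Y)"
  by (rule finite_subset[of _ "Pow (X \<times> Y)"]) (auto simp: diagrams_def)

lemma diagrams_finite_member: "finite X \<Longrightarrow> finite Y \<Longrightarrow> P \<in> diagrams X Y \<Longrightarrow> finite P"
  using diagrams_subset[of P X Y] finite_subset[of P "X \<times> Y"] by simp

lemma diagrams_empty: "diagrams {} {} = {{}}"
  by (auto simp: diagrams_def)

lemma bij_betw_snd_diagrams: "P \<in> diagrams X Y \<Longrightarrow> bij_betw snd P Y"
proof -
  assume P: "P \<in> diagrams X Y"
  have "Y \<subseteq> snd ` P"
  proof
    fix y assume "y \<in> Y"
    then obtain x where "(x, y) \<in> P" using P by (auto simp: diagrams_def)
    then show "y \<in> snd ` P" by force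
  qed
  then show ?thesis
    using diagrams_subset[OF P] diagrams_snd_inj[OF P] by (auto simp: bij_betw_def inj_on_def)
qed

lemma diagrams_insert:
  assumes "x \<in> X" "y \<in> Y" "P \<in> diagrams (X - {x}) (Y - {y})"
  shows "insert (x, y) P \<in> diagrams X Y"
proof -
  have sub: "P \<subseteq> (X - {x}) \<times> (Y - {y})" using assms(3) by (rule diagrams_subset)
  have "\<exists>!b. (a, b) \<in> insert (x, y) P" if "a \<in> X" for a
  proof (cases "a = x")
    case True
    then show ?thesis using sub by auto
  next
    case False
    then show ?thesis using assms(3) that by (simp add: diagrams_def)
  qed
  moreover have "\<exists>!a. (a, b) \<in> insert (x, y) P" if "b \<in> Y" for b
  proof (cases "b = y")
    case True
    then show ?thesis using sub by auto
  next
    case False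
    then show ?thesis using assms(3) that by (simp add: diagrams_def)
  qed
  ultimately show ?thesis using sub assms(1,2) by (auto simp: diagrams_def)
qed

lemma diagrams_remove:
  assumes "P \<in> diagrams X Y" "(x, y) \<in> P"
  shows "P - {(x, y)} \<in> diagrams (X - {x}) (Y - {y})"
proof -
  have sub: "P \<subseteq> X \<times> Y" using assms(1) by (rule diagrams_subset)
  have "\<exists>!b. (a, b) \<in> P - {(x, y)}" if "a \<in> X - {x}" for a
    using assms(1) that by (simp add: diagrams_def)
  moreover have "\<exists>!a. (a, b) \<in> P - {(x, y)}" if "b \<in> Y - {y}" for b
    using assms(1) that by (simp add: diagrams_def)
  moreover have "P - {(x, y)} \<subseteq> (X - {x}) \<times> (Y - {y})"
  proof
    fix p assume p: "p \<in> P - {(x, y)}"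
    then have "fst p \<noteq> x" "snd p \<noteq> y"
      using diagrams_fst_inj[OF assms(1) _ assms(2), of p] diagrams_snd_inj[OF assms(1) _ assms(2), of p]
      by auto
    then show "p \<in> (X - {x}) \<times> (Y - {y})" using sub p by (cases p) auto
  qed
  ultimately show ?thesis unfolding diagrams_def by blast
qed

lemma swap_image_diagrams: "P \<in> diagrams X Y \<Longrightarrow> prod.swap ` P \<in> diagrams Y X"
proof -
  assume P: "P \<in> diagrams X Y"
  have mem: "(a, b) \<in> prod.swap ` P \<longleftrightarrow> (b, a) \<in> P" for a b
    by (metis image_iff swap_simp swap_swap)
  have "prod.swap ` P \<subseteq> Y \<times> X" using diagrams_subset[OF P] by auto
  with P show ?thesis by (simp add: diagrams_def mem)
qed

lemma reverse_image_diagrams: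
  "P \<in> diagrams X Y \<Longrightarrow> map_prod uminus id ` P \<in> diagrams (uminus ` X) Y"
proof -
  assume P: "P \<in> diagrams X Y"
  have mem: "(a, b) \<in> map_prod uminus id ` P \<longleftrightarrow> (- a, b) \<in> P" for a b
  proof
    assume "(- a, b) \<in> P"
    then have "map_prod uminus id (- a, b) \<in> map_prod uminus id ` P" by (rule imageI)
    then show "(a, b) \<in> map_prod uminus id ` P" by simp
  qed auto
  have ex: "\<exists>!a. (- a, b) \<in> P" if "b \<in> Y" for b
  proof -
    from that P obtain a where "(a, b) \<in> P" by (auto simp: diagrams_def)
    then show ?thesis
      using diagrams_snd_inj[OF P] by (intro ex1I[of _ "- a"]) fastforce+
  qed
  have "map_prod uminus id ` P \<subseteq> uminus ` X \<times> Y" using diagrams_subset[OF P] by auto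
  with P show ?thesis by (simp add: diagrams_def mem ex)
qed

lemma bij_betw_swap_diagrams: "bij_betw ((`) prod.swap) (diagrams X Y) (diagrams Y X)"
proof (rule bij_betw_byWitness[where f' = "(`) prod.swap"])
  show "(`) prod.swap ` diagrams X Y \<subseteq> diagrams Y X" "(`) prod.swap ` diagrams Y X \<subseteq> diagrams X Y"
    by (rule image_subsetI, erule swap_image_diagrams)+
qed (simp_all add: image_image)

lemma bij_betw_reverse_diagrams:
  "bij_betw ((`) (map_prod uminus id)) (diagrams X Y) (diagrams (uminus ` X) Y)"
proof (rule bij_betw_byWitness[where f' = "(`) (map_prod uminus id)"])
  show "(`) (map_prod uminus id) ` diagrams X Y \<subseteq> diagrams (uminus ` X) Y"
    by (rule image_subsetI, erule reverse_image_diagrams)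
  show "(`) (map_prod uminus id) ` diagrams (uminus ` X) Y \<subseteq> diagrams X Y"
    using reverse_image_diagrams[of _ "uminus ` X" Y] by (force simp: image_image)
qed (simp_all add: image_image prod.map_comp o_def prod.map_id0 prod.map_ident)

section \<open>Sums over diagrams by the position of one point\<close>

lemma sum_diagrams_column:
  fixes f :: "(int \<times> int) set \<Rightarrow> nat"
  assumes "finite X" "finite Y" "x \<in> X"
  shows "(\<Sum>P\<in>diagrams X Y. f P) = (\<Sum>y\<in>Y. \<Sum>P\<in>diagrams (X - {x}) (Y - {y}). f (insert (x, y) P))"
proof -
  let ?D = "SIGMA y:Y. diagrams (X - {x}) (Y - {y})"
  have notin: "(x, b) \<notin> P" if "P \<in> diagrams (X - {x}) Z" for P Z b
    using diagrams_subset[OF that] by auto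
  \<comment> \<open>Column \<open>x\<close> holds exactly one point, so a diagram amounts to the
    height of that point together with the remaining diagram.\<close>
  have "bij_betw (\<lambda>(y, P). insert (x, y) P) ?D (diagrams X Y)"
    unfolding bij_betw_def
  proof
    show "inj_on (\<lambda>(y, P). insert (x, y) P) ?D"
    proof (rule inj_onI, clarify)
      fix y P y' P'
      assume P: "P \<in> diagrams (X - {x}) (Y - {y})" "P' \<in> diagrams (X - {x}) (Y - {y'})"
        and eq: "insert (x, y) P = insert (x, y') P'"
      have "y = y'" using eq notin[OF P(2), of y] by blast
      moreover have "P = P'"
        using eq insert_ident[OF notin[OF P(1), of y] notin[OF P(2), of y]] calculation by simp
      ultimately show "y = y' \<and> P = P'" by blast
    qed
    show "(\<lambda>(y, P). insert (x, y) P) ` ?D = diagrams X Y"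
    proof
      show "(\<lambda>(y, P). insert (x, y) P) ` ?D \<subseteq> diagrams X Y"
        using diagrams_insert[OF assms(3)] by auto
      show "diagrams X Y \<subseteq> (\<lambda>(y, P). insert (x, y) P) ` ?D"
      proof
        fix P assume P: "P \<in> diagrams X Y"
        then obtain y where y: "(x, y) \<in> P" using assms(3) by (auto simp: diagrams_def)
        have "(y, P - {(x, y)}) \<in> ?D"
          using diagrams_remove[OF P y] diagrams_subset[OF P] y by auto
        moreover have "P = (\<lambda>(y, P). insert (x, y) P) (y, P - {(x, y)})"
          using y by auto
        ultimately show "P \<in> (\<lambda>(y, P). insert (x, y) P) ` ?D"
          by (rule rev_image_eqI)
      qed
    qed
  qed
  then have "(\<Sum>P\<in>diagrams X Y. f P) = (\<Sum>z\<in>?D. f (case z of (y, P) \<Rightarrow> insert (x, y) P))"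
    by (rule sum.reindex_bij_betw[symmetric])
  also have "\<dots> = (\<Sum>(y, P)\<in>?D. f (insert (x, y) P))"
    by (simp add: case_prod_unfold)
  also have "\<dots> = (\<Sum>y\<in>Y. \<Sum>P\<in>diagrams (X - {x}) (Y - {y}). f (insert (x, y) P))"
    by (rule sum.Sigma[symmetric]) (use assms finite_diagrams in auto)
  finally show ?thesis .
qed

lemma sum_diagrams_swap:
  fixes f :: "(int \<times> int) set \<Rightarrow> nat"
  shows "(\<Sum>P\<in>diagrams X Y. f P) = (\<Sum>P\<in>diagrams Y X. f (prod.swap ` P))"
  using sum.reindex_bij_betw[OF bij_betw_swap_diagrams, of f Y X] by simp

lemma sum_diagrams_row:
  fixes f :: "(int \<times> int) set \<Rightarrow> nat"
  assumes "finite X" "finite Y" "y \<in> Y"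
  shows "(\<Sum>P\<in>diagrams X Y. f P) = (\<Sum>x\<in>X. \<Sum>P\<in>diagrams (X - {x}) (Y - {y}). f (insert (x, y) P))"
proof -
  have "(\<Sum>P\<in>diagrams X Y. f P) =
      (\<Sum>x\<in>X. \<Sum>P\<in>diagrams (Y - {y}) (X - {x}). f (prod.swap ` insert (y, x) P))"
    unfolding sum_diagrams_swap[of f X Y] by (rule sum_diagrams_column[OF assms(2,1,3)])
  also have "\<dots> = (\<Sum>x\<in>X. \<Sum>P\<in>diagrams (X - {x}) (Y - {y}). f (insert (x, y) P))"
    by (rule sum.cong[OF refl]) (simp add: sum_diagrams_swap[of _ "X - {_}"])
  finally show ?thesis .
qed

text \<open>The linear functional sending the monomial \<open>p^k * q^l\<close> to \<open>w k l\<close>, applied to \<open>\<Prod>i=2..m. (p + q + (i - 2))\<close>.\<close>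

fun stat_sum :: "nat \<Rightarrow> (nat \<Rightarrow> nat \<Rightarrow> nat) \<Rightarrow> nat" where
  "stat_sum 0 w = w 0 0"
| "stat_sum (Suc 0) w = w 0 0"
| "stat_sum (Suc (Suc m)) w = stat_sum (Suc m) (\<lambda>k l. w (Suc k) l + w k (Suc l) + m * w k l)"

lemma stat_sum_add: "stat_sum m (\<lambda>k l. u k l + v k l) = stat_sum m u + stat_sum m v"
proof (induction m u arbitrary: v rule: stat_sum.induct)
  case (3 m u)
  have "(\<lambda>k l. u (Suc k) l + v (Suc k) l + (u k (Suc l) + v k (Suc l)) + m * (u k l + v k l)) =
      (\<lambda>k l. (u (Suc k) l + u k (Suc l) + m * u k l) + (v (Suc k) l + v k (Suc l) + m * v k l))"
    by (simp add: algebra_simps)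
  then show ?case using 3 by simp
qed simp_all

lemma stat_sum_mult: "stat_sum m (\<lambda>k l. c * u k l) = c * stat_sum m u"
proof (induction m u rule: stat_sum.induct)
  case (3 m u)
  have "(\<lambda>k l. c * u (Suc k) l + c * u k (Suc l) + m * (c * u k l)) =
      (\<lambda>k l. c * (u (Suc k) l + u k (Suc l) + m * u k l))"
    by (simp add: algebra_simps)
  then show ?case using 3 by simp
qed simp_all

text \<open>Each factor \<open>p + q + (i - 2)\<close> is symmetric. Joint equidistribution comes
  from this symmetry, and it also absorbs the exchange of 12 and 21 under reversal.\<close>

lemma stat_sum_commute: "stat_sum m (\<lambda>k l. w l k) = stat_sum m w"
proof (induction m w rule: stat_sum.induct)
  case (3 m w)
  then show ?case by (simp add: add.commute)
qed simp_all

text \<open>The value \<open>a\<close> contributes \<open>p\<close>, the value \<open>b\<close>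
  contributes \<open>q\<close> and each of the other \<open>m\<close> values contributes 1, which
  makes up the last factor \<open>p + q + m\<close>.\<close>

lemma sum_stat_sum:
  assumes "finite Y" "card Y = Suc (Suc m)" "a \<in> Y" "b \<in> Y" "a \<noteq> b"
  shows "(\<Sum>y\<in>Y. stat_sum (Suc m) (\<lambda>k l. w (k + of_bool (y = a)) (l + of_bool (y = b)))) =
    stat_sum (Suc (Suc m)) w"
proof -
  let ?f = "\<lambda>y. stat_sum (Suc m) (\<lambda>k l. w (k + of_bool (y = a)) (l + of_bool (y = b)))"
  have "sum ?f Y = ?f a + sum ?f (Y - {a})"
    using assms by (simp add: sum.remove)
  also have "sum ?f (Y - {a}) = ?f b + sum ?f (Y - {a} - {b})"
    using assms by (subst sum.remove[of _ b]) auto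
  also have "sum ?f (Y - {a} - {b}) = sum (\<lambda>_. stat_sum (Suc m) w) (Y - {a} - {b})"
    by (rule sum.cong) auto
  also have "\<dots> = m * stat_sum (Suc m) w"
    using assms by (simp add: card_Diff_singleton)
  finally show ?thesis
    using assms by (simp add: stat_sum_add stat_sum_mult)
qed

section \<open>Mesh patterns of length two\<close>

text \<open>A coordinate on a grid line gets index 3 (4 for \<open>cell3\<close> below), which lies outside every shading.\<close>

definition cell2 :: "int \<Rightarrow> int \<Rightarrow> int \<Rightarrow> nat" where
  "cell2 x y t = (if t < x then 0 else if x < t \<and> t < y then 1 else if y < t then 2 else 3)"

lemma cell2_eq:
  "cell2 x y t = 0 \<longleftrightarrow> t < x"
  "cell2 x y t = Suc 0 \<longleftrightarrow> x < t \<and> t < y"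
  "x \<le> y \<Longrightarrow> cell2 x y t = 2 \<longleftrightarrow> y < t"
  by (auto simp: cell2_def)

text \<open>\<open>asc\<close> selects the pattern 12 or 21. Rows of boxes are counted from below
  whatever the pattern, hence \<open>min\<close> and \<open>max\<close> in the second
  coordinate.\<close>

definition occ2 :: "bool \<Rightarrow> (nat \<times> nat) set \<Rightarrow> (int \<times> int) set \<Rightarrow> ((int \<times> int) \<times> (int \<times> int)) set" where
  "occ2 asc S P = {(p, q). p \<in> P \<and> q \<in> P \<and> fst p < fst q \<and> snd p \<noteq> snd q \<and> (snd p < snd q) = asc \<and>
     (\<forall>r\<in>P. (cell2 (fst p) (fst q) (fst r),
              cell2 (min (snd p) (snd q)) (max (snd p) (snd q)) (snd r)) \<notin> S)}"

definition stat2 :: "(nat \<Rightarrow> nat \<Rightarrow> nat) \<Rightarrow> (nat \<times> nat) set \<Rightarrow> (int \<times> int) set \<Rightarrow> nat" where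
  "stat2 w S P = w (card (occ2 True S P)) (card (occ2 False S P))"

text \<open>Quantifying over all weights \<open>w\<close> expresses an identity of generating
  functions without polynomials: an indicator function as \<open>w\<close> extracts a single
  coefficient.\<close>

definition standard2 :: "(nat \<times> nat) set \<Rightarrow> bool" where
  "standard2 S \<longleftrightarrow> (\<forall>X Y w. finite X \<longrightarrow> finite Y \<longrightarrow> card X = card Y \<longrightarrow>
     (\<Sum>P\<in>diagrams X Y. stat2 w S P) = stat_sum (card X) w)"

lemma finite_occ2: "finite P \<Longrightarrow> finite (occ2 asc S P)"
  by (rule finite_subset[of _ "P \<times> P"]) (auto simp: occ2_def)

lemma occ2_empty: "occ2 asc S {} = {}"
  by (simp add: occ2_def)

lemma occ2_singleton: "occ2 asc S {p} = {}"
  by (auto simp: occ2_def)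

section \<open>Inversion and reversal of length-two occurrences\<close>

lemma occ2_swap_subset:
  "(\<lambda>(p, q). if asc then (prod.swap p, prod.swap q) else (prod.swap q, prod.swap p)) ` occ2 asc S P
   \<subseteq> occ2 asc (prod.swap ` S) (prod.swap ` P)"
proof -
  have mem: "(a, b) \<in> prod.swap ` S \<longleftrightarrow> (b, a) \<in> S" for a b
    by (metis image_iff swap_simp swap_swap)
  show ?thesis
    by (cases asc) (auto simp: occ2_def mem min_def max_def split: if_splits)
qed

lemma card_occ2_swap:
  "card (occ2 asc (prod.swap ` S) (prod.swap ` P)) = card (occ2 asc S P)"
proof -
  \<comment> \<open>Inversion keeps the left-to-right order of the two points of an ascent and
    exchanges the two points of a descent. The map is its own inverse, so one inclusion, used in
    both directions, gives the bijection.\<close>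
  let ?f = "\<lambda>(p, q). if asc then (prod.swap p, prod.swap q) else (prod.swap q, prod.swap p)"
  have inv: "?f (?f z) = z" for z :: "(int \<times> int) \<times> (int \<times> int)"
    by (cases z) auto
  have "bij_betw ?f (occ2 asc S P) (occ2 asc (prod.swap ` S) (prod.swap ` P))"
  proof (rule bij_betw_byWitness[where f' = ?f])
    show "?f ` occ2 asc (prod.swap ` S) (prod.swap ` P) \<subseteq> occ2 asc S P"
      using occ2_swap_subset[of asc "prod.swap ` S" "prod.swap ` P"] by (simp add: image_image)
  qed (use occ2_swap_subset inv in auto)
  then show ?thesis by (simp add: bij_betw_same_card)
qed

lemma standard2_swap:
  assumes "standard2 S"
  shows "standard2 (prod.swap ` S)"
  unfolding standard2_def
proof (intro allI impI)
  fix X Y :: "int set" and w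
  assume fin: "finite X" "finite Y" "card X = card Y"
  have "(\<Sum>P\<in>diagrams X Y. stat2 w (prod.swap ` S) P) =
      (\<Sum>P\<in>diagrams Y X. stat2 w (prod.swap ` S) (prod.swap ` P))"
    by (rule sum_diagrams_swap)
  also have "\<dots> = (\<Sum>P\<in>diagrams Y X. stat2 w S P)"
    by (simp only: stat2_def card_occ2_swap)
  also have "\<dots> = stat_sum (card X) w"
    using assms fin by (simp add: standard2_def)
  finally show "(\<Sum>P\<in>diagrams X Y. stat2 w (prod.swap ` S) P) = stat_sum (card X) w" .
qed

text \<open>The guard \<open>a \<le> 2\<close> is essential: with truncated subtraction the
  grid-line index 3 would otherwise be sent to column 0.\<close>

definition reverse_boxes :: "(nat \<times> nat) set \<Rightarrow> (nat \<times> nat) set" where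
  "reverse_boxes S = {(a, b). a \<le> 2 \<and> (2 - a, b) \<in> S}"

lemma reverse_reverse_boxes: "S \<subseteq> {0..2} \<times> T \<Longrightarrow> reverse_boxes (reverse_boxes S) = S"
  by (auto simp: reverse_boxes_def)

lemma occ2_reverse_subset:
  assumes "S \<subseteq> {0..2} \<times> {0..2}"
  shows "(\<lambda>(p, q). (map_prod uminus id q, map_prod uminus id p)) ` occ2 asc S P
    \<subseteq> occ2 (\<not> asc) (reverse_boxes S) (map_prod uminus id ` P)"
proof -
  have cell: "(cell2 (- y) (- x) (- t), c) \<in> reverse_boxes S \<longleftrightarrow> (cell2 x y t, c) \<in> S"
    if "x < y" for x y t c
    using assms that by (auto simp: cell2_def reverse_boxes_def)
  show ?thesis
    by (auto simp: occ2_def cell min.commute max.commute)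
qed

lemma card_occ2_reverse:
  assumes "S \<subseteq> {0..2} \<times> {0..2}"
  shows "card (occ2 (\<not> asc) (reverse_boxes S) (map_prod uminus id ` P)) = card (occ2 asc S P)"
proof -
  let ?f = "\<lambda>(p, q). (map_prod uminus id q, map_prod uminus id p) :: (int \<times> int) \<times> (int \<times> int)"
  have inv: "?f (?f z) = z" for z
    by (cases z) auto
  have sub: "reverse_boxes S \<subseteq> {0..2} \<times> {0..2}"
    using assms by (auto simp: reverse_boxes_def)
  have P: "map_prod uminus id ` map_prod uminus id ` P = P"
    by (simp add: image_image prod.map_comp o_def prod.map_id0 prod.map_ident)
  have "bij_betw ?f (occ2 asc S P) (occ2 (\<not> asc) (reverse_boxes S) (map_prod uminus id ` P))"
  proof (rule bij_betw_byWitness[where f' = ?f])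
    show "?f ` occ2 (\<not> asc) (reverse_boxes S) (map_prod uminus id ` P) \<subseteq> occ2 asc S P"
      using occ2_reverse_subset[OF sub, of "\<not> asc" "map_prod uminus id ` P"]
      unfolding P reverse_reverse_boxes[OF assms] by simp
  qed (use occ2_reverse_subset[OF assms] inv in auto)
  then show ?thesis by (simp add: bij_betw_same_card)
qed

text \<open>Reversal turns ascents into descents, so the arguments of \<open>w\<close> get
  exchanged; the symmetry of \<open>stat_sum\<close> undoes this.\<close>

lemma standard2_reverse:
  assumes "standard2 S" "S \<subseteq> {0..2} \<times> {0..2}"
  shows "standard2 (reverse_boxes S)"
  unfolding standard2_def
proof (intro allI impI)
  fix X Y :: "int set" and w
  assume fin: "finite X" "finite Y" "card X = card Y"
  have "stat2 w (reverse_boxes S) (map_prod uminus id ` P) = stat2 (\<lambda>k l. w l k) S P" for P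
    using card_occ2_reverse[OF assms(2), of True P] card_occ2_reverse[OF assms(2), of False P]
    by (simp add: stat2_def)
  then have *: "(\<Sum>P\<in>diagrams X Y. stat2 (\<lambda>k l. w l k) S P) =
      (\<Sum>P\<in>diagrams (uminus ` X) Y. stat2 w (reverse_boxes S) P)" for X
    using sum.reindex_bij_betw[OF bij_betw_reverse_diagrams, of "stat2 w (reverse_boxes S)" X Y] by simp
  \<comment> \<open>Negating twice restores \<open>X\<close>, so the previous fact is applied to the
    negated set.\<close>
  have "(\<Sum>P\<in>diagrams X Y. stat2 w (reverse_boxes S) P) =
      (\<Sum>P\<in>diagrams (uminus ` X) Y. stat2 (\<lambda>k l. w l k) S P)"
    using *[of "uminus ` X"] by (simp add: image_image)
  also have "\<dots> = stat_sum (card X) w"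
    using assms(1) fin stat_sum_commute[of _ w] by (simp add: standard2_def card_image)
  finally show "(\<Sum>P\<in>diagrams X Y. stat2 w (reverse_boxes S) P) = stat_sum (card X) w" .
qed

section \<open>Shadings settled by removing the leftmost point\<close>

lemma standard2_small:
  assumes "finite X" "finite Y" "card X = card Y" "card X \<le> 1"
  shows "(\<Sum>P\<in>diagrams X Y. stat2 w S P) = stat_sum (card X) w"
proof (cases "card X = 0")
  case True
  then have "X = {}" "Y = {}" using assms by auto
  then show ?thesis by (simp add: diagrams_empty stat2_def occ2_empty)
next
  case False
  then have "card X = 1" using assms(4) by simp
  then obtain x y where "X = {x}" "Y = {y}" using assms(3) by (metis card_1_singletonE)
  then show ?thesis
    using sum_diagrams_column[of X Y x "stat2 w S"]
    by (simp add: diagrams_empty stat2_def occ2_singleton)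
qed

text \<open>With no shading in column 0, a new leftmost point cannot destroy an occurrence among the
  old points. Every new occurrence uses it as first letter, since nothing lies further left.\<close>

lemma card_occ2_insert_left:
  assumes "finite P" "\<And>p. p \<in> P \<Longrightarrow> x < fst p" "\<And>p. p \<in> P \<Longrightarrow> snd p \<noteq> y" "S \<subseteq> {1,2} \<times> {0..2}"
  shows "card (occ2 asc S (insert (x, y) P)) = card (occ2 asc S P) +
    card {q \<in> P. (y < snd q) = asc \<and>
      (\<forall>r\<in>P. (cell2 x (fst q) (fst r), cell2 (min y (snd q)) (max y (snd q)) (snd r)) \<notin> S)}"
    (is "_ = _ + card ?N")
proof -
  \<comment> \<open>The new point is in column 0 if the pair is old and on a grid line, index 3, if
    it is itself the first letter.\<close>
  have "(cell2 (fst p) (fst q) x, c) \<notin> S" if "p \<in> P \<or> p = (x, y) \<and> q \<in> P" for p q c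
    using that assms(2)[of p] assms(2)[of q] assms(4) by (auto simp: cell2_def)
  then have skip: "(\<forall>r\<in>insert (x, y) P. (cell2 (fst p) (fst q) (fst r),
        cell2 (min (snd p) (snd q)) (max (snd p) (snd q)) (snd r)) \<notin> S) \<longleftrightarrow>
      (\<forall>r\<in>P. (cell2 (fst p) (fst q) (fst r),
        cell2 (min (snd p) (snd q)) (max (snd p) (snd q)) (snd r)) \<notin> S)"
    if "p \<in> P \<or> p = (x, y) \<and> q \<in> P" for p q
    using that by simp
  have notin: "(x, y) \<notin> P" using assms(2)[of "(x, y)"] by auto
  have "(p, q) \<in> occ2 asc S (insert (x, y) P) \<longleftrightarrow>
      (p, q) \<in> occ2 asc S P \<or> p = (x, y) \<and> q \<in> ?N" for p q
  proof (cases "q \<in> P")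
    case True
    then have neq: "q \<noteq> (x, y)" "y \<noteq> snd q" "x < fst q" using notin assms(2,3)[of q] by auto
    show ?thesis
    proof (cases "p = (x, y)")
      case p: True
      then show ?thesis
        using skip[of p q] True neq notin by (simp add: occ2_def)
    next
      case False
      then show ?thesis
        using skip[of p q] True by (cases "p \<in> P") (simp_all add: occ2_def)
    qed
  next
    case False
    have "\<not> fst p < x" if "p \<in> insert (x, y) P" using that assms(2)[of p] by auto
    then show ?thesis using False by (auto simp: occ2_def)
  qed
  then have "occ2 asc S (insert (x, y) P) = occ2 asc S P \<union> Pair (x, y) ` ?N"
    by (intro set_eqI) (auto simp del: mem_Collect_eq)
  moreover have "occ2 asc S P \<inter> Pair (x, y) ` ?N = {}"
    using notin by (auto simp: occ2_def)
  ultimately show ?thesis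
    using assms(1) by (simp add: card_Un_disjoint finite_occ2 card_image inj_on_def)
qed

text \<open>The number of occurrences created by the leftmost point depends only on its value
  \<open>y\<close> and on \<open>Y\<close>, not on the remaining diagram. Hence each removal splits
  off one factor: \<open>a Y\<close> is the value that creates a 12 and \<open>b Y\<close> the value
  that creates a 21.\<close>

lemma standard2_leftmost:
  assumes S: "S \<subseteq> {1,2} \<times> {0..2}"
    and ab: "\<And>Y. finite Y \<Longrightarrow> card Y \<ge> 2 \<Longrightarrow> a Y \<in> Y \<and> b Y \<in> Y \<and> a Y \<noteq> b Y"
    and count: "\<And>x y X Y P asc. finite Y \<Longrightarrow> card Y \<ge> 2 \<Longrightarrow> y \<in> Y \<Longrightarrow> P \<in> diagrams X (Y - {y}) \<Longrightarrow>
      (\<And>p. p \<in> P \<Longrightarrow> x < fst p) \<Longrightarrow>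
      card {q \<in> P. (y < snd q) = asc \<and>
        (\<forall>r\<in>P. (cell2 x (fst q) (fst r), cell2 (min y (snd q)) (max y (snd q)) (snd r)) \<notin> S)} =
      of_bool (y = (if asc then a Y else b Y))"
  shows "standard2 S"
  unfolding standard2_def
proof (intro allI impI)
  fix X Y :: "int set" and w
  assume "finite X" "finite Y" "card X = card Y"
  then show "(\<Sum>P\<in>diagrams X Y. stat2 w S P) = stat_sum (card X) w"
  proof (induction "card X" arbitrary: X Y w)
    case 0
    then show ?case by (simp add: standard2_small)
  next
    case (Suc n)
    \<comment> \<open>Size one is a base case as well: distinct \<open>a Y\<close> and
      \<open>b Y\<close> are available only from two values on.\<close>
    show ?case
    proof (cases n)
      case 0
      then show ?thesis using Suc standard2_small by simp
    next
    case n: (Suc m)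
      define x where "x = Min X"
      have "X \<noteq> {}" using Suc(2) by auto
      then have x: "x \<in> X" "\<And>z. z \<in> X - {x} \<Longrightarrow> x < z"
        using Suc(3) by (auto simp: x_def less_le)
      have Y: "finite Y" "card Y \<ge> 2" using Suc(2,4,5) n by auto
      have card: "card X = Suc (Suc m)" "card Y = Suc (Suc m)" using Suc(2,5) n by simp_all
      \<comment> \<open>Multiplication by \<open>p\<close> or \<open>q\<close> becomes a shift of
        the first or second argument of \<open>w\<close>.\<close>
      have ins: "stat2 w S (insert (x, y) P) =
          stat2 (\<lambda>k l. w (k + of_bool (y = a Y)) (l + of_bool (y = b Y))) S P"
        if y: "y \<in> Y" and P: "P \<in> diagrams (X - {x}) (Y - {y})" for y P
      proof -
        have "x < fst p" "snd p \<noteq> y" if "p \<in> P" for p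
          using diagrams_subset[OF P] that x(2) by auto
        moreover have "finite P" using diagrams_finite_member[OF _ _ P] Suc(3,4) by simp
        ultimately show ?thesis
          using card_occ2_insert_left[of P x y S] S count[OF Y y P, of x] by (simp add: stat2_def)
      qed
      have "(\<Sum>P\<in>diagrams X Y. stat2 w S P) =
          (\<Sum>y\<in>Y. \<Sum>P\<in>diagrams (X - {x}) (Y - {y}).
            stat2 (\<lambda>k l. w (k + of_bool (y = a Y)) (l + of_bool (y = b Y))) S P)"
        using Suc(3,4) x(1) by (simp add: sum_diagrams_column ins)
      also have "\<dots> = (\<Sum>y\<in>Y. stat_sum (Suc m) (\<lambda>k l. w (k + of_bool (y = a Y)) (l + of_bool (y = b Y))))"
      proof (rule sum.cong[OF refl])
        fix y assume "y \<in> Y"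
        then have "n = card (X - {x})" "card (X - {x}) = card (Y - {y})"
          using Suc(2-5) x(1) by simp_all
        then show "(\<Sum>P\<in>diagrams (X - {x}) (Y - {y}).
            stat2 (\<lambda>k l. w (k + of_bool (y = a Y)) (l + of_bool (y = b Y))) S P) =
          stat_sum (Suc m) (\<lambda>k l. w (k + of_bool (y = a Y)) (l + of_bool (y = b Y)))"
          using Suc(1)[of "X - {x}" "Y - {y}"] Suc(3,4) n by simp
      qed
      also have "\<dots> = stat_sum (card X) w"
        using sum_stat_sum[of Y m "a Y" "b Y" w] Y(1) card ab[OF Y] by (simp del: stat_sum.simps)
      finally show ?thesis .
    qed
  qed
qed

text \<open>Heights identify the points of a diagram, so a condition on heights alone can be counted
  in \<open>Y\<close>. This removes the dependence on the diagram.\<close>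

lemma card_filter_snd:
  assumes P: "P \<in> diagrams X Y"
    and C: "\<And>q r. q \<in> P \<Longrightarrow> r \<in> P \<Longrightarrow> C q r \<longleftrightarrow> C' (snd q) (snd r)"
  shows "card {q \<in> P. A (snd q) \<and> (\<forall>r\<in>P. C q r)} = card {u \<in> Y. A u \<and> (\<forall>v\<in>Y. C' u v)}"
proof -
  have img: "snd ` P = Y" and inj: "inj_on snd P"
    using bij_betw_snd_diagrams[OF P] by (auto simp: bij_betw_def)
  have eq: "snd ` {q \<in> P. A (snd q) \<and> (\<forall>r\<in>P. C q r)} = {u \<in> Y. A u \<and> (\<forall>v\<in>Y. C' u v)}"
    unfolding img[symmetric] by (auto simp: C image_iff) (use C in force)+
  have "inj_on snd {q \<in> P. A (snd q) \<and> (\<forall>r\<in>P. C q r)}"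
    using inj by (rule inj_on_subset) auto
  from card_image[OF this] show ?thesis by (simp only: eq)
qed

lemma Min_neq_Max:
  assumes "finite Y" "card Y \<ge> 2"
  shows "Y \<noteq> {} \<and> Min Y \<noteq> Max Y"
proof -
  have "Y \<subseteq> {Min Y}" if "Min Y = Max Y"
  proof
    fix v assume "v \<in> Y"
    then have "Min Y \<le> v" "v \<le> Max Y" using assms by auto
    then show "v \<in> {Min Y}" using that by simp
  qed
  then show ?thesis
    using assms card_mono[of "{Min Y}" Y] by fastforce
qed

lemma Min_diff_Min:
  assumes "finite Y" "card Y \<ge> 2"
  shows "Y \<noteq> {} \<and> Min (Y - {Min Y}) \<in> Y - {Min Y}"
proof -
  have "Y - {Min Y} \<noteq> {}"
  proof
    assume "Y - {Min Y} = {}"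
    then have "card Y \<le> card {Min Y}" by (intro card_mono) auto
    then show False using assms(2) by simp
  qed
  then show ?thesis using assms(1) by (metis Diff_empty Min_in empty_Diff finite_Diff)
qed

text \<open>If all values lie between \<open>y\<close> and \<open>u\<close>, these two are the
  extremes of \<open>Y\<close>, and \<open>asc\<close> decides which of them is
  \<open>y\<close>.\<close>

lemma min_max_filter:
  fixes Y :: "int set"
  assumes "a \<in> Y" "b \<in> Y" "a \<noteq> b" "\<And>v. v \<in> Y \<Longrightarrow> a \<le> v" "\<And>v. v \<in> Y \<Longrightarrow> v \<le> b" "y \<in> Y"
  shows "{u \<in> Y - {y}. (y < u) = asc \<and> (\<forall>v\<in>Y - {y}. min y u \<le> v \<and> v \<le> max y u)} =
      (if y = (if asc then a else b) then {if asc then b else a} else {})"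
proof -
  have less: "a < b" using assms(2,3) assms(4)[of b] by simp
  have "u \<in> Y - {y} \<and> (y < u) = asc \<and> (\<forall>v\<in>Y - {y}. min y u \<le> v \<and> v \<le> max y u) \<longleftrightarrow>
      y = (if asc then a else b) \<and> u = (if asc then b else a)" (is "?L \<longleftrightarrow> ?R") for u
  proof
    assume L: ?L
    have "y = a \<or> min y u \<le> a" "y = b \<or> b \<le> max y u" using L assms(1,2) by auto
    moreover have "a \<le> y" "y \<le> b" "a \<le> u" "u \<le> b" using L assms(4-6) by auto
    ultimately show ?R using L less unfolding min_def max_def by (auto split: if_splits)
  next
    assume R: ?R
    then show ?L
      using less assms(1,2,4,5) by (cases asc) (simp_all add: min_absorb1 min_absorb2 max_absorb1 max_absorb2)
  qed
  then show ?thesis by (intro set_eqI) simp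
qed

text \<open>If all other values lie above both \<open>y\<close> and \<open>u\<close>, these two are
  the smallest values of \<open>Y\<close>, and \<open>asc\<close> decides which of them is
  \<open>y\<close>.\<close>

lemma next_smallest_filter:
  fixes Y :: "int set"
  assumes "a \<in> Y" "b \<in> Y - {a}" "\<And>v. v \<in> Y \<Longrightarrow> a \<le> v" "\<And>v. v \<in> Y - {a} \<Longrightarrow> b \<le> v" "y \<in> Y"
  shows "{u \<in> Y - {y}. (y < u) = asc \<and> (\<forall>v\<in>Y - {y}. v = u \<or> max y u \<le> v)} =
      (if y = (if asc then a else b) then {if asc then b else a} else {})"
proof -
  have less: "a < b" using assms(2) assms(3)[of b] by auto
  have "u \<in> Y - {y} \<and> (y < u) = asc \<and> (\<forall>v\<in>Y - {y}. v = u \<or> max y u \<le> v) \<longleftrightarrow>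
      y = (if asc then a else b) \<and> u = (if asc then b else a)" (is "?L \<longleftrightarrow> ?R") for u
  proof
    assume L: ?L
    have "y = a \<or> a = u \<or> max y u \<le> a" "y = b \<or> b = u \<or> max y u \<le> b" using L assms(1,2) by auto
    moreover have "a \<le> y" "a \<le> u" "y = a \<or> b \<le> y" "u = a \<or> b \<le> u" using L assms(3-5) by auto
    ultimately show ?R using L less unfolding max_def by (auto split: if_splits)
  next
    assume R: ?R
    have "v = a \<or> b \<le> v" if "v \<in> Y" for v using assms(4)[of v] that by auto
    then show ?L using R less assms(1,2) by (cases asc) auto
  qed
  then show ?thesis by (intro set_eqI) simp
qed

text \<open>Every point other than the two letters lies in column 1 or 2 when the first letter is
  leftmost. Shading rows 0 and 2 there forces all of them between the letters, so the letters are
  the minimum and the maximum.\<close>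

lemma standard2_min_max: "standard2 {(1,0), (1,2), (2,0), (2,2)}" (is "standard2 ?S")
proof (rule standard2_leftmost[where a = Min and b = Max])
  fix Y :: "int set" assume Y: "finite Y" "card Y \<ge> 2"
  then show "Min Y \<in> Y \<and> Max Y \<in> Y \<and> Min Y \<noteq> Max Y" using Min_neq_Max[OF Y] by auto
next
  fix x y X Y P asc
  assume Y: "finite Y" "card Y \<ge> 2" "y \<in> Y" and P: "P \<in> diagrams X (Y - {y})"
    and x: "\<And>p. p \<in> P \<Longrightarrow> x < fst p"
  have ab: "Min Y \<in> Y" "Max Y \<in> Y" "Min Y \<noteq> Max Y"
    using Min_neq_Max[OF Y(1,2)] Y by auto
  have "(cell2 x (fst q) (fst r), cell2 (min y (snd q)) (max y (snd q)) (snd r)) \<notin> ?S \<longleftrightarrow>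
      min y (snd q) \<le> snd r \<and> snd r \<le> max y (snd q)" if "q \<in> P" "r \<in> P" for q r
  proof (cases "r = q")
    case False
    then have "fst r \<noteq> fst q" using diagrams_fst_inj[OF P that] by auto
    then have "cell2 x (fst q) (fst r) \<in> {1, 2}" using x[OF that(2)] by (auto simp: cell2_def)
    then have notin: "(cell2 x (fst q) (fst r), d) \<notin> ?S \<longleftrightarrow> d \<noteq> 0 \<and> d \<noteq> 2" for d by auto
    show ?thesis unfolding notin by (auto simp: cell2_eq not_less)
  qed (simp add: cell2_def)
  from card_filter_snd[where A = "\<lambda>v. (y < v) = asc" and C' = "\<lambda>u v. min y u \<le> v \<and> v \<le> max y u", OF P this]
  have "card {q \<in> P. (y < snd q) = asc \<and>
      (\<forall>r\<in>P. (cell2 x (fst q) (fst r), cell2 (min y (snd q)) (max y (snd q)) (snd r)) \<notin> ?S)} =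
      card {u \<in> Y - {y}. (y < u) = asc \<and> (\<forall>v\<in>Y - {y}. min y u \<le> v \<and> v \<le> max y u)}" .
  also have "{u \<in> Y - {y}. (y < u) = asc \<and> (\<forall>v\<in>Y - {y}. min y u \<le> v \<and> v \<le> max y u)} =
      (if y = (if asc then Min Y else Max Y) then {if asc then Max Y else Min Y} else {})"
    using min_max_filter[of "Min Y" Y "Max Y" y asc] ab Y by auto
  finally show "card {q \<in> P. (y < snd q) = asc \<and>
      (\<forall>r\<in>P. (cell2 x (fst q) (fst r), cell2 (min y (snd q)) (max y (snd q)) (snd r)) \<notin> ?S)} =
      of_bool (y = (if asc then Min Y else Max Y))"
    by simp
qed auto

text \<open>Here rows 0 and 1 are shaded in columns 1 and 2, so the other points must lie above both
  letters: the letters carry the two smallest values.\<close>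

lemma standard2_next_smallest: "standard2 {(1,0), (1,1), (2,0), (2,1)}" (is "standard2 ?S")
proof (rule standard2_leftmost[where a = Min and b = "\<lambda>Y. Min (Y - {Min Y})"])
  fix Y :: "int set" assume Y: "finite Y" "card Y \<ge> 2"
  then show "Min Y \<in> Y \<and> Min (Y - {Min Y}) \<in> Y \<and> Min Y \<noteq> Min (Y - {Min Y})"
    using Min_diff_Min[OF Y] by auto
next
  fix x y X Y P asc
  assume Y: "finite Y" "card Y \<ge> 2" "y \<in> Y" and P: "P \<in> diagrams X (Y - {y})"
    and x: "\<And>p. p \<in> P \<Longrightarrow> x < fst p"
  have ab: "Min Y \<in> Y" "Min (Y - {Min Y}) \<in> Y - {Min Y}"
    using Min_diff_Min[OF Y(1,2)] Y by auto
  have "(cell2 x (fst q) (fst r), cell2 (min y (snd q)) (max y (snd q)) (snd r)) \<notin> ?S \<longleftrightarrow>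
      snd r = snd q \<or> max y (snd q) \<le> snd r" if "q \<in> P" "r \<in> P" for q r
  proof (cases "r = q")
    case False
    then have neq: "fst r \<noteq> fst q" "snd r \<noteq> snd q" "snd r \<noteq> y"
      using diagrams_fst_inj[OF P that] diagrams_snd_inj[OF P that] diagrams_subset[OF P] that by auto
    then have "cell2 x (fst q) (fst r) \<in> {1, 2}" using x[OF that(2)] by (auto simp: cell2_def)
    then have notin: "(cell2 x (fst q) (fst r), d) \<notin> ?S \<longleftrightarrow> d \<noteq> 0 \<and> d \<noteq> 1" for d by auto
    show ?thesis unfolding notin using neq by (auto simp: cell2_eq max_def min_def)
  qed (simp add: cell2_def)
    from card_filter_snd[where A = "\<lambda>v. (y < v) = asc" and C' = "\<lambda>u v. v = u \<or> max y u \<le> v", OF P this]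
  have "card {q \<in> P. (y < snd q) = asc \<and>
      (\<forall>r\<in>P. (cell2 x (fst q) (fst r), cell2 (min y (snd q)) (max y (snd q)) (snd r)) \<notin> ?S)} =
      card {u \<in> Y - {y}. (y < u) = asc \<and> (\<forall>v\<in>Y - {y}. v = u \<or> max y u \<le> v)}" .
  also have "{u \<in> Y - {y}. (y < u) = asc \<and> (\<forall>v\<in>Y - {y}. v = u \<or> max y u \<le> v)} =
      (if y = (if asc then Min Y else Min (Y - {Min Y}))
       then {if asc then Min (Y - {Min Y}) else Min Y} else {})"
    using next_smallest_filter[of "Min Y" Y "Min (Y - {Min Y})" y asc] ab Y by auto
  finally show "card {q \<in> P. (y < snd q) = asc \<and>
      (\<forall>r\<in>P. (cell2 x (fst q) (fst r), cell2 (min y (snd q)) (max y (snd q)) (snd r)) \<notin> ?S)} =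
      of_bool (y = (if asc then Min Y else Min (Y - {Min Y})))"
    by simp
qed auto

text \<open>The same functional applied to the product of the rising factorials of \<open>p\<close> of length \<open>b\<close> and of \<open>q\<close>
  of length \<open>c\<close>.\<close>

function side_sum :: "nat \<Rightarrow> nat \<Rightarrow> (nat \<Rightarrow> nat \<Rightarrow> nat) \<Rightarrow> nat" where
  "side_sum b c w = (if b = 0 \<and> c = 0 then w 0 0 else
     (if b = 0 then 0 else side_sum (b - 1) c (\<lambda>k l. w (Suc k) l) + (b - 1) * side_sum (b - 1) c w) +
     (if c = 0 then 0 else side_sum b (c - 1) (\<lambda>k l. w k (Suc l)) + (c - 1) * side_sum b (c - 1) w))"
  by pat_completeness auto
termination by (relation "measure (\<lambda>(b, c, w). b + c)") auto

declare side_sum.simps [simp del]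

section \<open>Linearity and convolution of \<open>side_sum\<close>\<close>

lemma side_sum_add: "side_sum b c (\<lambda>k l. u k l + v k l) = side_sum b c u + side_sum b c v"
proof (induction "b + c" arbitrary: b c u v)
  case 0
  then show ?case by (simp add: side_sum.simps)
next
  case (Suc n)
  have "side_sum (b - 1) c (\<lambda>k l. u k l + v k l) = side_sum (b - 1) c u + side_sum (b - 1) c v"
    if "b \<noteq> 0" for u v using Suc(1)[of "b - 1" c] Suc(2) that by simp
  moreover have "side_sum b (c - 1) (\<lambda>k l. u k l + v k l) = side_sum b (c - 1) u + side_sum b (c - 1) v"
    if "c \<noteq> 0" for u v using Suc(1)[of b "c - 1"] Suc(2) that by simp
  ultimately show ?case
    by (simp add: side_sum.simps[of b c] add_mult_distrib2)
qed

lemma side_sum_mult: "side_sum b c (\<lambda>k l. d * u k l) = d * side_sum b c u"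
proof (induction "b + c" arbitrary: b c u)
  case 0
  then show ?case by (simp add: side_sum.simps)
next
  case (Suc n)
  have "side_sum (b - 1) c (\<lambda>k l. d * u k l) = d * side_sum (b - 1) c u"
    if "b \<noteq> 0" for u using Suc(1)[of "b - 1" c] Suc(2) that by simp
  moreover have "side_sum b (c - 1) (\<lambda>k l. d * u k l) = d * side_sum b (c - 1) u"
    if "c \<noteq> 0" for u using Suc(1)[of b "c - 1"] Suc(2) that by simp
  ultimately show ?case
    by (simp add: side_sum.simps[of b c] add_mult_distrib2 ac_simps)
qed

text \<open>The recursion of \<open>side_sum\<close> also produces the binomial coefficient of
  \<open>b + c\<close> over \<open>b\<close>, the number of ways to interleave the two sides. With
  this multiplicity the identity is the Vandermonde convolution for rising factorials, whose right
  side is the rising factorial of \<open>p + q\<close> of length \<open>m\<close>.\<close>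

lemma sum_side_sum: "(\<Sum>b\<le>m. side_sum b (m - b) w) = stat_sum (Suc m) w"
proof (induction m arbitrary: w)
  case 0
  then show ?case by (simp add: side_sum.simps)
next
  case (Suc m)
  \<comment> \<open>The functions \<open>f\<close> and \<open>g\<close> are the two halves of the
    recursion, one lowering the first index and one lowering the second. After an index shift both
    sums run over \<open>b \<le> m\<close>.\<close>
  define f where "f b c = side_sum b c (\<lambda>k l. w (Suc k) l) + b * side_sum b c w" for b c
  define g where "g b c = side_sum b c (\<lambda>k l. w k (Suc l)) + c * side_sum b c w" for b c
  have "(\<Sum>b\<le>Suc m. side_sum b (Suc m - b) w) =
      (\<Sum>b\<le>Suc m. (if b = 0 then 0 else f (b - 1) (Suc m - b)) + (if b = Suc m then 0 else g b (m - b)))"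
    by (rule sum.cong[OF refl], subst side_sum.simps) (auto simp: f_def g_def)
  also have "\<dots> = (\<Sum>b\<le>Suc m. if b = 0 then 0 else f (b - 1) (Suc m - b)) +
      (\<Sum>b\<le>Suc m. if b = Suc m then 0 else g b (m - b))"
    by (rule sum.distrib)
  also have "(\<Sum>b\<le>Suc m. if b = 0 then 0 else f (b - 1) (Suc m - b)) = (\<Sum>b\<le>m. f b (m - b))"
    by (subst sum.atMost_Suc_shift) simp
  also have "(\<Sum>b\<le>Suc m. if b = Suc m then 0 else g b (m - b)) = (\<Sum>b\<le>m. g b (m - b))"
    unfolding sum.atMost_Suc by (simp cong: sum.cong_simp)
  also have "(\<Sum>b\<le>m. f b (m - b)) + (\<Sum>b\<le>m. g b (m - b)) = (\<Sum>b\<le>m. f b (m - b) + g b (m - b))"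
    by (rule sum.distrib[symmetric])
  also have "\<dots> = (\<Sum>b\<le>m. side_sum b (m - b) (\<lambda>k l. w (Suc k) l + w k (Suc l) + m * w k l))"
  proof (rule sum.cong[OF refl])
    fix b assume "b \<in> {..m}"
    \<comment> \<open>The coefficients \<open>b\<close> and \<open>m - b\<close> add up to the
      constant \<open>m\<close> of the next factor \<open>p + q + m\<close>.\<close>
    then have "b * s + (m - b) * s = m * s" for s by (simp add: add_mult_distrib[symmetric])
    then show "f b (m - b) + g b (m - b) = side_sum b (m - b) (\<lambda>k l. w (Suc k) l + w k (Suc l) + m * w k l)"
      by (simp add: f_def g_def side_sum_add side_sum_mult)
  qed
  also have "\<dots> = stat_sum (Suc (Suc m)) w"
    by (simp add: Suc)
  finally show ?case .
qed

text \<open>The number of larger values is a rank, decreasing along \<open>Y\<close>. It turns a sum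
  over values into a sum over an initial segment of the naturals.\<close>

lemma bij_betw_card_greater:
  fixes Y :: "int set"
  assumes "finite Y"
  shows "bij_betw (\<lambda>a. card {y \<in> Y. a < y}) Y {..<card Y}"
proof -
  have "card {y \<in> Y. b < y} < card {y \<in> Y. a < y}" if "b \<in> Y" "a < b" for a b
    using assms that by (intro psubset_card_mono) auto
  then have inj: "inj_on (\<lambda>a. card {y \<in> Y. a < y}) Y"
    by (intro inj_onI) (metis linorder_neqE less_irrefl)
  have "(\<lambda>a. card {y \<in> Y. a < y}) ` Y \<subseteq> {..<card Y}"
    using assms by (auto intro!: psubset_card_mono)
  then have "(\<lambda>a. card {y \<in> Y. a < y}) ` Y = {..<card Y}"
    by (rule card_subset_eq[rotated]) (simp_all add: card_image[OF inj])
  with inj show ?thesis by (simp add: bij_betw_def)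
qed

lemma card_less_greater:
  fixes Y :: "int set"
  assumes "finite Y" "a \<in> Y"
  shows "card {y \<in> Y. y < a} + card {y \<in> Y. a < y} = card Y - 1"
proof -
  have eq: "Y - {a} = {y \<in> Y. y < a} \<union> {y \<in> Y. a < y}" by auto
  have "card (Y - {a}) = card {y \<in> Y. y < a} + card {y \<in> Y. a < y}"
    unfolding eq by (rule card_Un_disjoint) (use assms(1) in auto)
  then show ?thesis using assms by simp
qed

lemma sum_side_sum_over_values:
  fixes Y :: "int set"
  assumes "finite Y" "card Y = Suc m"
  shows "(\<Sum>a\<in>Y. side_sum (card {y \<in> Y. a < y}) (card {y \<in> Y. y < a}) w) = stat_sum (Suc m) w"
proof -
  have "(\<Sum>a\<in>Y. side_sum (card {y \<in> Y. a < y}) (card {y \<in> Y. y < a}) w) =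
      (\<Sum>a\<in>Y. side_sum (card {y \<in> Y. a < y}) (m - card {y \<in> Y. a < y}) w)"
  proof (rule sum.cong[OF refl])
    fix a assume "a \<in> Y"
    then have "card {y \<in> Y. y < a} = m - card {y \<in> Y. a < y}"
      using card_less_greater[of Y a] assms by simp
    then show "side_sum (card {y \<in> Y. a < y}) (card {y \<in> Y. y < a}) w =
        side_sum (card {y \<in> Y. a < y}) (m - card {y \<in> Y. a < y}) w" by simp
  qed
  also have "\<dots> = (\<Sum>b\<in>{..<card Y}. side_sum b (m - b) w)"
    by (rule sum.reindex_bij_betw[OF bij_betw_card_greater[OF assms(1)]])
  also have "\<dots> = stat_sum (Suc m) w"
    by (simp add: assms(2) lessThan_Suc_atMost sum_side_sum)
  finally show ?thesis .
qed

section \<open>Points above and below a fixed leftmost value\<close>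

lemma ball_diagrams_snd: "P \<in> diagrams X Y \<Longrightarrow> (\<forall>r\<in>P. Q (snd r)) \<longleftrightarrow> (\<forall>v\<in>Y. Q v)"
  using bij_betw_snd_diagrams[of P X Y] by (auto simp: bij_betw_def)

text \<open>These are the possible second letters when the first letter is a leftmost point of
  height \<open>a\<close> and box \<open>(2,1)\<close> is shaded. Above \<open>a\<close> they are
  the right-to-left minima among the points above \<open>a\<close>, below \<open>a\<close> the
  right-to-left maxima among the points below; such records have rising factorials as generating
  functions.\<close>

definition side_occ :: "bool \<Rightarrow> int \<Rightarrow> (int \<times> int) set \<Rightarrow> (int \<times> int) set" where
  "side_occ asc a P = {q \<in> P. (a < snd q) = asc \<and>
     (\<forall>r\<in>P. fst q < fst r \<longrightarrow> \<not> (min a (snd q) < snd r \<and> snd r < max a (snd q)))}"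

text \<open>The defining condition only looks to the right, so a new leftmost point leaves the old
  letters as they are. It counts itself exactly if no value separates it from \<open>a\<close>,
  which depends on \<open>y\<close> and \<open>Y\<close> alone.\<close>

lemma card_side_occ_insert_left:
  assumes P: "P \<in> diagrams X Y" and "finite P" and x: "\<And>p. p \<in> P \<Longrightarrow> x < fst p"
  shows "card (side_occ asc a (insert (x, y) P)) = card (side_occ asc a P) +
    of_bool ((a < y) = asc \<and> (\<forall>v\<in>Y. \<not> (min a y < v \<and> v < max a y)))"
proof -
  let ?B = "(a < y) = asc \<and> (\<forall>v\<in>Y. \<not> (min a y < v \<and> v < max a y))"
  have notin: "(x, y) \<notin> P" using x[of "(x, y)"] by auto
  have B: "?B \<longleftrightarrow> (a < y) = asc \<and> (\<forall>r\<in>P. \<not> (min a y < snd r \<and> snd r < max a y))"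
    using ball_diagrams_snd[OF P, of "\<lambda>v. \<not> (min a y < v \<and> v < max a y)"] by simp
  have old: "q \<in> side_occ asc a (insert (x, y) P) \<longleftrightarrow> q \<in> side_occ asc a P" if "q \<in> P" for q
    using x[OF that] that by (simp add: side_occ_def)
  have new: "(x, y) \<in> side_occ asc a (insert (x, y) P) \<longleftrightarrow> ?B"
    unfolding B using x by (simp add: side_occ_def)
  have notocc: "(x, y) \<notin> side_occ asc a P" using notin by (simp add: side_occ_def)
  have "side_occ asc a (insert (x, y) P) = (if ?B then insert (x, y) (side_occ asc a P) else side_occ asc a P)"
  proof (rule set_eqI)
    fix q
    consider "q = (x, y)" | "q \<in> P" | "q \<noteq> (x, y)" "q \<notin> P" by blast
    then show "q \<in> side_occ asc a (insert (x, y) P) \<longleftrightarrow>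
        q \<in> (if ?B then insert (x, y) (side_occ asc a P) else side_occ asc a P)"
    proof cases
      case 1
      then show ?thesis using new notocc by simp
    next
      case 2
      then show ?thesis using old[OF 2] notin by auto
    next
      case 3
      then show ?thesis by (simp add: side_occ_def)
    qed
  qed
  moreover have "finite (side_occ asc a P)" using assms(2) by (simp add: side_occ_def)
  ultimately show ?thesis using notocc by simp
qed


lemma sum_one_exception:
  fixes f :: "int \<Rightarrow> nat"
  assumes "finite H" "b = card H" "H \<noteq> {} \<Longrightarrow> z \<in> H"
    and "\<And>y. y \<in> H \<Longrightarrow> f y = (if y = z then s else t)"
  shows "sum f H = (if b = 0 then 0 else s + (b - 1) * t)"
proof (cases "H = {}")
  case False
  then have z: "z \<in> H" by (rule assms(3))
  have "sum f H = f z + sum f (H - {z})" using assms(1) z by (rule sum.remove)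
  also have "sum f (H - {z}) = sum (\<lambda>_. t) (H - {z})"
    by (rule sum.cong) (use assms(4) in auto)
  finally show ?thesis using assms z False by simp
qed (use assms in simp)

text \<open>Removing the leftmost point gives the recursion of \<open>side_sum\<close>: among the
  values above \<open>a\<close> only the smallest creates a 12, among those below only the largest
  creates a 21, and every other value contributes 1.\<close>

lemma sum_side_occ:
  assumes "finite X" "finite Y" "card X = card Y" "a \<notin> Y"
  shows "(\<Sum>P\<in>diagrams X Y. w (card (side_occ True a P)) (card (side_occ False a P))) =
    side_sum (card {y \<in> Y. a < y}) (card {y \<in> Y. y < a}) w"
  using assms
proof (induction "card X" arbitrary: X Y w)
  case 0
  then have "X = {}" "Y = {}" by auto
  then show ?case by (simp add: diagrams_empty side_occ_def side_sum.simps)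
next
  case (Suc n)
  define x where "x = Min X"
  have "X \<noteq> {}" using Suc(2) by auto
  then have x: "x \<in> X" "\<And>z. z \<in> X - {x} \<Longrightarrow> x < z"
    using Suc(3) by (auto simp: x_def less_le)
  define H where "H = {y \<in> Y. a < y}"
  define L where "L = {y \<in> Y. y < a}"
  have "y < a \<or> a < y" if "y \<in> Y" for y
    using that Suc(6) by (cases y a rule: linorder_cases) auto
  then have HL: "finite H" "finite L" "Y = H \<union> L" "H \<inter> L = {}"
    using Suc(4) by (auto simp: H_def L_def)
  have H1: "{v \<in> Y - {y}. a < v} = H - {y}" and L1: "{v \<in> Y - {y}. v < a} = L - {y}" for y
    by (auto simp: H_def L_def)
  define F where "F y = (\<Sum>P\<in>diagrams (X - {x}) (Y - {y}).
      w (card (side_occ True a (insert (x, y) P))) (card (side_occ False a (insert (x, y) P))))" for y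
  have F: "F y = side_sum (card (H - {y})) (card (L - {y}))
      (\<lambda>k l. w (k + of_bool ((a < y) = True \<and> (\<forall>v\<in>Y - {y}. \<not> (min a y < v \<and> v < max a y))))
             (l + of_bool ((a < y) = False \<and> (\<forall>v\<in>Y - {y}. \<not> (min a y < v \<and> v < max a y)))))"
    if "y \<in> Y" for y
  proof -
    have "card (side_occ asc a (insert (x, y) P)) = card (side_occ asc a P) +
      of_bool ((a < y) = asc \<and> (\<forall>v\<in>Y - {y}. \<not> (min a y < v \<and> v < max a y)))"
      if P: "P \<in> diagrams (X - {x}) (Y - {y})" for asc P
    proof (rule card_side_occ_insert_left[OF P])
      show "finite P" using diagrams_finite_member[OF _ _ P] Suc(3,4) by simp
      show "x < fst p" if "p \<in> P" for p using diagrams_subset[OF P] that x(2) by auto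
    qed
    then have "F y = (\<Sum>P\<in>diagrams (X - {x}) (Y - {y}).
      (\<lambda>k l. w (k + of_bool ((a < y) = True \<and> (\<forall>v\<in>Y - {y}. \<not> (min a y < v \<and> v < max a y))))
             (l + of_bool ((a < y) = False \<and> (\<forall>v\<in>Y - {y}. \<not> (min a y < v \<and> v < max a y)))))
        (card (side_occ True a P)) (card (side_occ False a P)))"
      unfolding F_def by (intro sum.cong refl) simp
    also have "\<dots> = side_sum (card {v \<in> Y - {y}. a < v}) (card {v \<in> Y - {y}. v < a})
      (\<lambda>k l. w (k + of_bool ((a < y) = True \<and> (\<forall>v\<in>Y - {y}. \<not> (min a y < v \<and> v < max a y))))
             (l + of_bool ((a < y) = False \<and> (\<forall>v\<in>Y - {y}. \<not> (min a y < v \<and> v < max a y)))))"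
      by (rule Suc(1)) (use Suc(2-6) x(1) that in auto)
    finally show ?thesis unfolding H1 L1 .
  qed
  have sumH: "sum F H = (if card H = 0 then 0 else side_sum (card H - 1) (card L) (\<lambda>k l. w (Suc k) l) +
      (card H - 1) * side_sum (card H - 1) (card L) w)"
  proof (rule sum_one_exception[where z = "Min H"])
    fix y assume y: "y \<in> H"
    then have "min a y = a" "max a y = y" by (auto simp: H_def)
    \<comment> \<open>Only values above \<open>a\<close> can lie strictly between \<open>a\<close>
      and \<open>y\<close>, so the gap is empty exactly if \<open>y\<close> is the lowest of
      \<open>H\<close>.\<close>
    then have "(\<forall>v\<in>Y - {y}. \<not> (min a y < v \<and> v < max a y)) \<longleftrightarrow> (\<forall>v\<in>H. y \<le> v)"
      unfolding Diff_iff Ball_def by (auto simp: H_def not_less)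
    also have "\<dots> \<longleftrightarrow> y = Min H"
      using y HL(1) by (metis Min_eqI Min_le)
    finally have "(\<forall>v\<in>Y - {y}. \<not> (min a y < v \<and> v < max a y)) \<longleftrightarrow> y = Min H" .
    moreover have "a < y" "y \<in> Y" "L - {y} = L" using y by (auto simp: H_def L_def)
    ultimately show "F y = (if y = Min H then side_sum (card H - 1) (card L) (\<lambda>k l. w (Suc k) l)
        else side_sum (card H - 1) (card L) w)"
      using F[of y] y HL(1) by simp
  qed (use HL in auto)
  have sumL: "sum F L = (if card L = 0 then 0 else side_sum (card H) (card L - 1) (\<lambda>k l. w k (Suc l)) +
      (card L - 1) * side_sum (card H) (card L - 1) w)"
  proof (rule sum_one_exception[where z = "Max L"])
    fix y assume y: "y \<in> L"
    then have "min a y = y" "max a y = a" by (auto simp: L_def)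
    then have "(\<forall>v\<in>Y - {y}. \<not> (min a y < v \<and> v < max a y)) \<longleftrightarrow> (\<forall>v\<in>L. v \<le> y)"
      by (auto simp: L_def not_less)
    also have "\<dots> \<longleftrightarrow> y = Max L"
      using y HL(2) by (metis Max_eqI Max_ge)
    finally have "(\<forall>v\<in>Y - {y}. \<not> (min a y < v \<and> v < max a y)) \<longleftrightarrow> y = Max L" .
    moreover have "\<not> a < y" "y \<in> Y" "H - {y} = H" using y by (auto simp: H_def L_def)
    ultimately show "F y = (if y = Max L then side_sum (card H) (card L - 1) (\<lambda>k l. w k (Suc l))
        else side_sum (card H) (card L - 1) w)"
      using F[of y] y HL(2) by simp
  qed (use HL in auto)
  have "card H + card L = Suc n"
    using Suc(2,5) HL by (metis card_Un_disjoint)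
  then have nz: "\<not> (card H = 0 \<and> card L = 0)" by linarith
  have "(\<Sum>P\<in>diagrams X Y. w (card (side_occ True a P)) (card (side_occ False a P))) = sum F Y"
    unfolding F_def by (rule sum_diagrams_column[OF Suc(3,4) x(1)])
  also have "\<dots> = sum F H + sum F L"
    unfolding HL(3) by (rule sum.union_disjoint[OF HL(1,2,4)])
  also have "\<dots> = side_sum (card H) (card L) w"
    unfolding sumH sumL by (subst (3) side_sum.simps) (use nz in auto)
  finally show ?case unfolding H_def L_def .
qed

text \<open>Column 0 is shaded completely, so nothing may lie left of the first letter, which must
  be the leftmost point. The remaining box \<open>(2,1)\<close> is the condition in
  \<open>side_occ\<close>.\<close>

lemma occ2_first_fixed:
  assumes "\<And>p. p \<in> P \<Longrightarrow> x < fst p" "\<And>p. p \<in> P \<Longrightarrow> snd p \<noteq> a"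
  shows "occ2 asc {(0,0), (0,1), (0,2), (2,1)} (insert (x, a) P) = Pair (x, a) ` side_occ asc a P"
    (is "occ2 asc ?S _ = _")
proof -
  have notin: "(x, a) \<notin> P" using assms(1)[of "(x, a)"] by auto
  have "(p, q) \<in> occ2 asc ?S (insert (x, a) P) \<longleftrightarrow> p = (x, a) \<and> q \<in> side_occ asc a P" for p q
  proof (cases "p = (x, a) \<and> q \<in> P")
    case True
    have "(cell2 x (fst q) x, c) \<notin> ?S" for c
      using True assms(1)[of q] by (simp add: cell2_def)
    moreover have "(cell2 x (fst q) (fst r), cell2 (min a (snd q)) (max a (snd q)) (snd r)) \<notin> ?S \<longleftrightarrow>
        (fst q < fst r \<longrightarrow> \<not> (min a (snd q) < snd r \<and> snd r < max a (snd q)))" if "r \<in> P" for r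
    proof -
      have "cell2 x (fst q) (fst r) \<noteq> 0" using assms(1)[OF that] by (simp add: cell2_def)
      moreover have "cell2 x (fst q) (fst r) = 2 \<longleftrightarrow> fst q < fst r"
        using assms(1)[of q] True by (simp add: cell2_eq)
      moreover have "cell2 (min a (snd q)) (max a (snd q)) (snd r) = 1 \<longleftrightarrow>
          min a (snd q) < snd r \<and> snd r < max a (snd q)"
        using cell2_eq(2) by simp
      ultimately show ?thesis by auto
    qed
    ultimately show ?thesis
      using True assms(1)[of q] assms(2)[of q] by (simp add: occ2_def side_occ_def)
  next
    case False
    have "(p, q) \<notin> occ2 asc ?S (insert (x, a) P)"
    proof
      assume *: "(p, q) \<in> occ2 asc ?S (insert (x, a) P)"
      then have mem: "p \<in> insert (x, a) P" "q \<in> insert (x, a) P" "fst p < fst q"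
        and box: "(cell2 (fst p) (fst q) x, cell2 (min (snd p) (snd q)) (max (snd p) (snd q)) a) \<notin> ?S"
        by (simp_all add: occ2_def)
      have "x \<le> fst p" using mem(1) assms(1)[of p] by auto
      then have q: "q \<in> P" using mem(2,3) by auto
      with False have p: "p \<in> P" using mem(1) by auto
      \<comment> \<open>With both letters in \<open>P\<close>, the leftmost point lies in column 0
        and on no horizontal grid line, hence in a shaded box.\<close>
      have "min (snd p) (snd q) \<noteq> a" "max (snd p) (snd q) \<noteq> a"
        using assms(2)[OF p] assms(2)[OF q] by (simp_all add: min_def max_def)
      then have "cell2 (min (snd p) (snd q)) (max (snd p) (snd q)) a \<in> {0, 1, 2}"
        by (auto simp: cell2_def)
      moreover have "cell2 (fst p) (fst q) x = 0" using assms(1)[OF p] by (simp add: cell2_def)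
      ultimately show False using box by auto
    qed
    then show ?thesis using False by (auto simp: side_occ_def)
  qed
  then show ?thesis by (intro set_eqI) (auto simp del: mem_Collect_eq)
qed

text \<open>For each value \<open>a\<close> of the leftmost point the two sides are counted by
  \<open>side_sum\<close>; summing over \<open>a\<close> gives the Vandermonde convolution.\<close>

lemma standard2_first_fixed: "standard2 {(0,0), (0,1), (0,2), (2,1)}" (is "standard2 ?S")
  unfolding standard2_def
proof (intro allI impI)
  fix X Y :: "int set" and w
  assume fin: "finite X" "finite Y" "card X = card Y"
  show "(\<Sum>P\<in>diagrams X Y. stat2 w ?S P) = stat_sum (card X) w"
  proof (cases "card X")
    case 0
    then show ?thesis using fin standard2_small by simp
  next
    case (Suc m)
    define x where "x = Min X"
    have "X \<noteq> {}" using Suc by auto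
    then have x: "x \<in> X" "\<And>z. z \<in> X - {x} \<Longrightarrow> x < z"
      using fin(1) by (auto simp: x_def less_le)
    have "stat2 w ?S (insert (x, a) P) = w (card (side_occ True a P)) (card (side_occ False a P))"
      if P: "P \<in> diagrams (X - {x}) (Y - {a})" for a P
    proof -
      have "x < fst p" "snd p \<noteq> a" if "p \<in> P" for p
        using diagrams_subset[OF P] that x(2) by auto
      then have "occ2 asc ?S (insert (x, a) P) = Pair (x, a) ` side_occ asc a P" for asc
        by (rule occ2_first_fixed)
      moreover have "card (Pair (x, a) ` side_occ asc a P) = card (side_occ asc a P)" for asc
        by (rule card_image) (simp add: inj_on_def)
      ultimately show ?thesis by (simp only: stat2_def)
    qed
    then have "(\<Sum>P\<in>diagrams X Y. stat2 w ?S P) = (\<Sum>a\<in>Y. \<Sum>P\<in>diagrams (X - {x}) (Y - {a}).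
        w (card (side_occ True a P)) (card (side_occ False a P)))"
      using fin x(1) by (simp add: sum_diagrams_column)
    also have "\<dots> = (\<Sum>a\<in>Y. side_sum (card {y \<in> Y - {a}. a < y}) (card {y \<in> Y - {a}. y < a}) w)"
      by (rule sum.cong[OF refl], rule sum_side_occ) (use fin x(1) in auto)
    also have "\<dots> = (\<Sum>a\<in>Y. side_sum (card {y \<in> Y. a < y}) (card {y \<in> Y. y < a}) w)"
    proof (rule sum.cong[OF refl])
      fix a
      have "{y \<in> Y - {a}. a < y} = {y \<in> Y. a < y}" "{y \<in> Y - {a}. y < a} = {y \<in> Y. y < a}" by auto
      then show "side_sum (card {y \<in> Y - {a}. a < y}) (card {y \<in> Y - {a}. y < a}) w =
        side_sum (card {y \<in> Y. a < y}) (card {y \<in> Y. y < a}) w" by simp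
    qed
    also have "\<dots> = stat_sum (card X) w"
      using sum_side_sum_over_values[of Y m w] fin Suc by simp
    finally show ?thesis .
  qed
qed

section \<open>Mesh patterns of length three\<close>

text \<open>The indices 12, 13 and 17 are proved directly. Reversal gives 11 from 12 and 14 from 13;
  inversion gives 9, 10, 15, 16 and 18 from 11, 12, 13, 14 and 17.\<close>

lemma standard2_S_boxes:
  assumes "9 \<le> j" "j \<le> 18"
  shows "standard2 {(a, b). (Suc a, Suc b) \<in> S_boxes j}"
proof -
  let ?T = "\<lambda>j. {(a, b). (Suc a, Suc b) \<in> S_boxes j}"
  have sub: "?T j \<subseteq> {0..2} \<times> {0..2}" for j
    by (auto simp: S_boxes_def split: if_splits)
  have T: "?T 9 = {(0,0), (0,1), (2,0), (2,1)}" "?T 10 = {(0,1), (0,2), (2,1), (2,2)}"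
    "?T 11 = {(0,0), (0,2), (1,0), (1,2)}" "?T 12 = {(1,0), (1,2), (2,0), (2,2)}"
    "?T 13 = {(0,0), (0,1), (0,2), (2,1)}" "?T 14 = {(0,1), (2,0), (2,1), (2,2)}"
    "?T 15 = {(0,0), (1,0), (1,2), (2,0)}" "?T 16 = {(0,2), (1,0), (1,2), (2,2)}"
    "?T 17 = {(1,0), (1,1), (2,0), (2,1)}" "?T 18 = {(0,1), (0,2), (1,1), (1,2)}"
    by (auto simp: S_boxes_def)
  have 12: "standard2 (?T 12)" unfolding T by (rule standard2_min_max)
  have 13: "standard2 (?T 13)" unfolding T by (rule standard2_first_fixed)
  have 17: "standard2 (?T 17)" unfolding T by (rule standard2_next_smallest)
  have "?T 11 = reverse_boxes (?T 12)"
    unfolding T by (auto simp: reverse_boxes_def)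
  then have 11: "standard2 (?T 11)" using standard2_reverse[OF 12 sub] by simp
  have "?T 9 = prod.swap ` ?T 11" "?T 10 = prod.swap ` ?T 12"
    unfolding T by auto
  then have 9: "standard2 (?T 9)" and 10: "standard2 (?T 10)"
    using standard2_swap[OF 11] standard2_swap[OF 12] by simp_all
  have "?T 14 = reverse_boxes (?T 13)"
    unfolding T by (auto simp: reverse_boxes_def)
  then have 14: "standard2 (?T 14)" using standard2_reverse[OF 13 sub] by simp
  have "?T 15 = prod.swap ` ?T 13" "?T 16 = prod.swap ` ?T 14" "?T 18 = prod.swap ` ?T 17"
    unfolding T by auto
  then have 15: "standard2 (?T 15)" and 16: "standard2 (?T 16)" and 18: "standard2 (?T 18)"
    using standard2_swap[OF 13] standard2_swap[OF 14] standard2_swap[OF 17] by simp_all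
  have "j = 9 \<or> j = 10 \<or> j = 11 \<or> j = 12 \<or> j = 13 \<or> j = 14 \<or> j = 15 \<or> j = 16 \<or> j = 17 \<or> j = 18"
    using assms by presburger
  then show ?thesis
    using 9 10 11 12 13 14 15 16 17 18 by (elim disjE) (simp_all only:)
qed

section \<open>Length-three occurrences, sorted by the leftmost point\<close>

definition cell3 :: "int \<Rightarrow> int \<Rightarrow> int \<Rightarrow> int \<Rightarrow> nat" where
  "cell3 x y z t = (if t < x then 0 else if x < t \<and> t < y then 1 else if y < t \<and> t < z then 2
     else if z < t then 3 else 4)"

definition occ3 :: "bool \<Rightarrow> (nat \<times> nat) set \<Rightarrow> (int \<times> int) set \<Rightarrow>
    ((int \<times> int) \<times> (int \<times> int) \<times> (int \<times> int)) set" where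
  "occ3 asc R P = {(p, q, r). p \<in> P \<and> q \<in> P \<and> r \<in> P \<and> fst p < fst q \<and> fst q < fst r \<and>
     snd p < snd q \<and> snd p < snd r \<and> snd q \<noteq> snd r \<and> (snd q < snd r) = asc \<and>
     (\<forall>s\<in>P. (cell3 (fst p) (fst q) (fst r) (fst s),
              cell3 (snd p) (min (snd q) (snd r)) (max (snd q) (snd r)) (snd s)) \<notin> R)}"

definition stat3 :: "(nat \<Rightarrow> nat \<Rightarrow> nat) \<Rightarrow> (nat \<times> nat) set \<Rightarrow> (int \<times> int) set \<Rightarrow> nat" where
  "stat3 w R P = w (card (occ3 True R P)) (card (occ3 False R P))"

text \<open>The number of ways to insert \<open>c\<close> low values into a permutation of \<open>b\<close> high values.\<close>

fun low_count :: "nat \<Rightarrow> nat \<Rightarrow> nat" where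
  "low_count 0 b = 1"
| "low_count (Suc c) b = Suc (c + b) * low_count c b"

text \<open>The index \<open>b\<close> is the number of points above the leftmost one, and
  \<open>n - 1 - b\<close> is the number below it. The empty diagram has no leftmost point, hence
  its own case.\<close>

definition total_sum :: "nat \<Rightarrow> (nat \<Rightarrow> nat \<Rightarrow> nat) \<Rightarrow> nat" where
  "total_sum n w = (if n = 0 then w 0 0 else (\<Sum>b<n. low_count (n - 1 - b) b * stat_sum b w))"

text \<open>The target depends on the size only, so any two shadings with this property have the
  same joint distribution.\<close>

definition standard3 :: "(nat \<times> nat) set \<Rightarrow> bool" where
  "standard3 R \<longleftrightarrow> (\<forall>X Y w. finite X \<longrightarrow> finite Y \<longrightarrow> card X = card Y \<longrightarrow>
     (\<Sum>P\<in>diagrams X Y. stat3 w R P) = total_sum (card X) w)"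

lemma total_sum_commute: "total_sum n (\<lambda>k l. w l k) = total_sum n w"
  unfolding total_sum_def stat_sum_commute[of _ w] by simp

text \<open>Deleting a row at height at most \<open>y\<close> leaves the points above
  \<open>y\<close> unchanged, and the deleted point may have stood in any column. The number of
  columns is the next factor of \<open>low_count\<close>.\<close>

lemma sum_stat2_above:
  assumes "standard2 T" "finite X" "finite Y" "card X = card Y"
  shows "(\<Sum>P\<in>diagrams X Y. stat2 w T {p \<in> P. y < snd p}) =
    low_count (card {v \<in> Y. v \<le> y}) (card {v \<in> Y. y < v}) * stat_sum (card {v \<in> Y. y < v}) w"
  using assms(2-)
proof (induction "card {v \<in> Y. v \<le> y}" arbitrary: X Y)
  case 0
  then have "{v \<in> Y. v \<le> y} = {}" by simp
  then have Y: "{v \<in> Y. y < v} = Y" by (auto simp: not_le[symmetric])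
  have above: "{p \<in> P. y < snd p} = P" if "P \<in> diagrams X Y" for P
    using diagrams_subset[OF that] Y by auto
  have "(\<Sum>P\<in>diagrams X Y. stat2 w T {p \<in> P. y < snd p}) = (\<Sum>P\<in>diagrams X Y. stat2 w T P)"
    by (rule sum.cong[OF refl]) (simp only: above)
  also have "\<dots> = stat_sum (card X) w"
    using assms(1) 0 by (simp add: standard2_def)
  finally show ?case unfolding Y using 0 by (simp flip: 0(1))
next
  case (Suc c)
  then have "{v \<in> Y. v \<le> y} \<noteq> {}" by (metis card.empty nat.distinct(1))
  then obtain v0 where v0: "v0 \<in> Y" "v0 \<le> y" by auto
  have low: "{v \<in> Y - {v0}. v \<le> y} = {v \<in> Y. v \<le> y} - {v0}" by auto
  have high: "{v \<in> Y - {v0}. y < v} = {v \<in> Y. y < v}" using v0(2) by auto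
  have c: "c = card {v \<in> Y - {v0}. v \<le> y}"
    unfolding low using Suc(2) v0 Suc(4) by simp
  have "{v \<in> Y. v \<le> y} \<union> {v \<in> Y. y < v} = Y" by auto
  then have "card Y = card {v \<in> Y. v \<le> y} + card {v \<in> Y. y < v}"
    using card_Un_disjoint[of "{v \<in> Y. v \<le> y}" "{v \<in> Y. y < v}"] Suc(4) by fastforce
  then have cardX: "card X = Suc (c + card {v \<in> Y. y < v})"
    using Suc(2,5) by simp
  have skip: "{p \<in> insert (x, v0) P. y < snd p} = {p \<in> P. y < snd p}" for x :: int and P
    using v0(2) by auto
  have "(\<Sum>P\<in>diagrams X Y. stat2 w T {p \<in> P. y < snd p}) =
      (\<Sum>x\<in>X. \<Sum>P\<in>diagrams (X - {x}) (Y - {v0}). stat2 w T {p \<in> P. y < snd p})"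
    using sum_diagrams_row[OF Suc(3,4) v0(1), of "\<lambda>P. stat2 w T {p \<in> P. y < snd p}"]
    by (simp only: skip)
  also have "\<dots> = (\<Sum>x\<in>X. low_count c (card {v \<in> Y. y < v}) * stat_sum (card {v \<in> Y. y < v}) w)"
  proof (rule sum.cong[OF refl])
    fix x assume "x \<in> X"
    then show "(\<Sum>P\<in>diagrams (X - {x}) (Y - {v0}). stat2 w T {p \<in> P. y < snd p}) =
        low_count c (card {v \<in> Y. y < v}) * stat_sum (card {v \<in> Y. y < v}) w"
      using Suc(1)[OF c, of "X - {x}"] Suc(3-5) v0(1) unfolding high c[symmetric] by simp
  qed
  also have "\<dots> = low_count (Suc c) (card {v \<in> Y. y < v}) * stat_sum (card {v \<in> Y. y < v}) w"
    by (simp add: cardX algebra_simps)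
  finally show ?case unfolding Suc(2) .
qed

text \<open>This isolates what remains to be shown for each shading: once the leftmost point
  \<open>(x, y)\<close> is fixed, occurrences are as many as length-two occurrences above
  \<open>y\<close>.\<close>

lemma standard3_if_reduces:
  assumes "standard2 T"
    and red: "\<And>X Y P x y asc. finite P \<Longrightarrow> P \<in> diagrams X Y \<Longrightarrow> y \<notin> Y \<Longrightarrow> (\<And>p. p \<in> P \<Longrightarrow> x < fst p) \<Longrightarrow>
      card (occ3 asc R (insert (x, y) P)) = card (occ2 asc T {p \<in> P. y < snd p})"
  shows "standard3 R"
  unfolding standard3_def
proof (intro allI impI)
  fix X Y :: "int set" and w
  assume fin: "finite X" "finite Y" "card X = card Y"
  show "(\<Sum>P\<in>diagrams X Y. stat3 w R P) = total_sum (card X) w"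
  proof (cases "X = {}")
    case True
    moreover have "occ3 asc R {} = {}" for asc by (auto simp: occ3_def)
    ultimately show ?thesis
      using fin by (simp add: diagrams_empty stat3_def total_sum_def)
  next
    case False
    define x where "x = Min X"
    have x: "x \<in> X" "\<And>z. z \<in> X - {x} \<Longrightarrow> x < z"
      using fin(1) False by (auto simp: x_def less_le)
    have ins: "stat3 w R (insert (x, y) P) = stat2 w T {p \<in> P. y < snd p}"
      if P: "P \<in> diagrams (X - {x}) (Y - {y})" for y P
    proof -
      have "finite P" using diagrams_finite_member[OF _ _ P] fin by simp
      moreover have "x < fst p" if "p \<in> P" for p
        using diagrams_subset[OF P] that x(2) by auto
      ultimately show ?thesis using red[OF _ P] by (simp add: stat3_def stat2_def)
    qed
    have "(\<Sum>P\<in>diagrams X Y. stat3 w R P) =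
        (\<Sum>y\<in>Y. \<Sum>P\<in>diagrams (X - {x}) (Y - {y}). stat3 w R (insert (x, y) P))"
      by (rule sum_diagrams_column[OF fin(1,2) x(1)])
    also have "\<dots> = (\<Sum>y\<in>Y. \<Sum>P\<in>diagrams (X - {x}) (Y - {y}). stat2 w T {p \<in> P. y < snd p})"
      by (intro sum.cong refl ins)
    \<comment> \<open>Written as a function of the rank of \<open>y\<close> from above, so that the
      sum can be reindexed by that rank.\<close>
    also have "\<dots> = (\<Sum>y\<in>Y. (\<lambda>b. low_count (card X - 1 - b) b * stat_sum b w) (card {v \<in> Y. y < v}))"
    proof (rule sum.cong[OF refl])
      fix y assume y: "y \<in> Y"
      have "{v \<in> Y - {y}. v \<le> y} = {v \<in> Y. v < y}" and high: "{v \<in> Y - {y}. y < v} = {v \<in> Y. y < v}"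
        by auto
      then have low: "card {v \<in> Y - {y}. v \<le> y} = card X - 1 - card {v \<in> Y. y < v}"
        using card_less_greater[OF fin(2) y] fin(3) by simp
      show "(\<Sum>P\<in>diagrams (X - {x}) (Y - {y}). stat2 w T {p \<in> P. y < snd p}) =
          (\<lambda>b. low_count (card X - 1 - b) b * stat_sum b w) (card {v \<in> Y. y < v})"
        using sum_stat2_above[OF assms(1), of "X - {x}" "Y - {y}" w y] fin x(1) y
        unfolding high low by simp
    qed
    also have "\<dots> = (\<Sum>b\<in>{..<card Y}. low_count (card X - 1 - b) b * stat_sum b w)"
      by (rule sum.reindex_bij_betw[OF bij_betw_card_greater[OF fin(2)]])
    also have "\<dots> = total_sum (card X) w"
    proof -
      have "card X \<noteq> 0" using False fin(1) by simp
      then show ?thesis unfolding total_sum_def fin(3)[symmetric] by simp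
    qed
    finally show ?thesis .
  qed
qed

section \<open>Inversion of length-three occurrences\<close>

lemma occ3_swap_subset:
  "(\<lambda>(p, q, r). if asc then (prod.swap p, prod.swap q, prod.swap r)
      else (prod.swap p, prod.swap r, prod.swap q)) ` occ3 asc R P
   \<subseteq> occ3 asc (prod.swap ` R) (prod.swap ` P)"
proof -
  have mem: "(a, b) \<in> prod.swap ` R \<longleftrightarrow> (b, a) \<in> R" for a b
    by (metis image_iff swap_simp swap_swap)
  show ?thesis
    by (cases asc) (auto simp: occ3_def mem min_def max_def split: if_splits)
qed

lemma card_occ3_swap:
  "card (occ3 asc (prod.swap ` R) (prod.swap ` P)) = card (occ3 asc R P)"
proof -
  \<comment> \<open>The patterns 123 and 132 are involutions. Inverting an occurrence of 132
    exchanges the left-to-right order of its two upper points.\<close>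
  let ?f = "\<lambda>(p, q, r). if asc then (prod.swap p, prod.swap q, prod.swap r)
      else (prod.swap p, prod.swap r, prod.swap q)"
  have inv: "?f (?f z) = z" for z :: "(int \<times> int) \<times> (int \<times> int) \<times> (int \<times> int)"
    by (cases z) auto
  have "bij_betw ?f (occ3 asc R P) (occ3 asc (prod.swap ` R) (prod.swap ` P))"
  proof (rule bij_betw_byWitness[where f' = ?f])
    show "?f ` occ3 asc (prod.swap ` R) (prod.swap ` P) \<subseteq> occ3 asc R P"
      using occ3_swap_subset[of asc "prod.swap ` R" "prod.swap ` P"] by (simp add: image_image)
  qed (use occ3_swap_subset inv in auto)
  then show ?thesis by (simp add: bij_betw_same_card)
qed

lemma standard3_swap:
  assumes "standard3 R"
  shows "standard3 (prod.swap ` R)"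
  unfolding standard3_def
proof (intro allI impI)
  fix X Y :: "int set" and w
  assume fin: "finite X" "finite Y" "card X = card Y"
  have "(\<Sum>P\<in>diagrams X Y. stat3 w (prod.swap ` R) P) =
      (\<Sum>P\<in>diagrams Y X. stat3 w (prod.swap ` R) (prod.swap ` P))"
    by (rule sum_diagrams_swap)
  also have "\<dots> = (\<Sum>P\<in>diagrams Y X. stat3 w R P)"
    by (simp only: stat3_def card_occ3_swap)
  also have "\<dots> = total_sum (card X) w"
    using assms fin by (simp add: standard3_def)
  finally show "(\<Sum>P\<in>diagrams X Y. stat3 w (prod.swap ` R) P) = total_sum (card X) w" .
qed

section \<open>Reduction of the shadings to length two\<close>

lemma occ3_iff: "(p, q, r) \<in> occ3 asc R P \<longleftrightarrow> p \<in> P \<and> q \<in> P \<and> r \<in> P \<and> fst p < fst q \<and> fst q < fst r \<and>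
    snd p < snd q \<and> snd p < snd r \<and> snd q \<noteq> snd r \<and> (snd q < snd r) = asc \<and>
    (\<forall>s\<in>P. (cell3 (fst p) (fst q) (fst r) (fst s),
             cell3 (snd p) (min (snd q) (snd r)) (max (snd q) (snd r)) (snd s)) \<notin> R)"
  by (simp add: occ3_def)

lemma occ2_iff: "(p, q) \<in> occ2 asc S P \<longleftrightarrow> p \<in> P \<and> q \<in> P \<and> fst p < fst q \<and> snd p \<noteq> snd q \<and>
    (snd p < snd q) = asc \<and>
    (\<forall>r\<in>P. (cell2 (fst p) (fst q) (fst r),
             cell2 (min (snd p) (snd q)) (max (snd p) (snd q)) (snd r)) \<notin> S)"
  by (simp add: occ2_def)

text \<open>The shaded column 0 forces the first letter to be the leftmost point. Outside that
  column row 0 is free, so points below the first letter impose nothing; the other boxes are those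
  of \<open>T\<close>, shifted by one.\<close>

lemma standard3_X_boxes:
  assumes "standard2 T" and T: "T \<subseteq> {0..2} \<times> {0..2}"
  shows "standard3 ({(0,0), (0,1), (0,2), (0,3)} \<union> {(Suc a, Suc b) | a b. (a, b) \<in> T})" (is "standard3 ?R")
proof (rule standard3_if_reduces[OF assms(1)])
  fix X Y P x y asc
  assume P: "P \<in> diagrams X Y" and y: "y \<notin> Y" and x: "\<And>p. p \<in> P \<Longrightarrow> x < fst p"
  define R where "R = ?R"
  let ?G = "insert (x, y) P" and ?U = "{p \<in> P. y < snd p}"
  have notin: "(x, y) \<notin> P" using x[of "(x, y)"] by auto
  have y': "snd p \<noteq> y" if "p \<in> P" for p using diagrams_subset[OF P] that y by auto
  have R_mem: "(0, b) \<in> R \<longleftrightarrow> b \<le> 3" "(Suc a, 0) \<notin> R" "(Suc a, Suc b) \<in> R \<longleftrightarrow> (a, b) \<in> T" "(4, b) \<notin> R" for a b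
    using T by (auto simp: R_def)
  have box: "(cell3 x (fst q) (fst r) (fst s), cell3 y lo hi (snd s)) \<notin> R \<longleftrightarrow>
      (y < snd s \<longrightarrow> (cell2 (fst q) (fst r) (fst s), cell2 lo hi (snd s)) \<notin> T)"
    if "q \<in> P" "s \<in> P" "y < lo" "y < hi" for q r s lo hi
  proof -
    have col: "cell3 x (fst q) (fst r) (fst s) = Suc (cell2 (fst q) (fst r) (fst s))"
      using x[OF that(2)] by (simp add: cell2_def cell3_def)
    show ?thesis
    proof (cases "y < snd s")
      case True
      then have "cell3 y lo hi (snd s) = Suc (cell2 lo hi (snd s))" by (simp add: cell2_def cell3_def)
      then show ?thesis unfolding col using True R_mem(3) by simp
    next
      case False
      then have "cell3 y lo hi (snd s) = 0" using y'[OF that(2)] by (simp add: cell3_def)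
      then show ?thesis unfolding col using False R_mem(2) by simp
    qed
  qed
  \<comment> \<open>The leftmost point, as first letter, lies on a grid line, which has index 4 and
    is outside every shading.\<close>
  have box0: "(cell3 x (fst q) (fst r) x, b) \<notin> R" if "q \<in> P" "fst q < fst r" for q r b
  proof -
    have "cell3 x (fst q) (fst r) x = 4" using x[OF that(1)] that(2) by (simp add: cell3_def)
    then show ?thesis using R_mem(4) by simp
  qed
  have "(p, q, r) \<in> occ3 asc R ?G \<longleftrightarrow> p = (x, y) \<and> (q, r) \<in> occ2 asc T ?U" for p q r
  proof
    assume *: "(p, q, r) \<in> occ3 asc R ?G"
    then have mem: "p \<in> ?G" "q \<in> ?G" "r \<in> ?G" "fst p < fst q" "fst q < fst r"
      "snd p < snd q" "snd p < snd r" "snd q \<noteq> snd r" "(snd q < snd r) = asc"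
      and b: "\<And>s. s \<in> ?G \<Longrightarrow> (cell3 (fst p) (fst q) (fst r) (fst s),
              cell3 (snd p) (min (snd q) (snd r)) (max (snd q) (snd r)) (snd s)) \<notin> R"
      unfolding occ3_iff by blast+
    have "x \<le> fst p" using mem(1) x[of p] by auto
    then have q: "q \<in> P" and r: "r \<in> P" using mem(2-5) by auto
    have p: "p = (x, y)"
    proof (rule ccontr)
      assume "p \<noteq> (x, y)"
      then have p: "p \<in> P" using mem(1) by simp
      then have "cell3 (fst p) (fst q) (fst r) x = 0" using x[OF p] by (simp add: cell3_def)
      then have "\<not> cell3 (snd p) (min (snd q) (snd r)) (max (snd q) (snd r)) y \<le> 3"
        using b[of "(x, y)"] R_mem(1) by simp
      moreover have "min (snd q) (snd r) \<noteq> y" "max (snd q) (snd r) \<noteq> y"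
        using y'[OF q] y'[OF r] by (simp_all add: min_def max_def)
      ultimately show False using y'[OF p] by (auto simp: cell3_def split: if_splits)
    qed
    have U: "q \<in> ?U" "r \<in> ?U" using q r mem(6,7) p by simp_all
    have "(cell2 (fst q) (fst r) (fst s), cell2 (min (snd q) (snd r)) (max (snd q) (snd r)) (snd s)) \<notin> T"
      if "s \<in> ?U" for s
      using b[of s] box[OF q, of s "min (snd q) (snd r)" "max (snd q) (snd r)" r] U that p
      by (simp add: less_max_iff_disj)
    then show "p = (x, y) \<and> (q, r) \<in> occ2 asc T ?U"
      using p U mem(5,8,9) unfolding occ2_iff by blast
  next
    assume "p = (x, y) \<and> (q, r) \<in> occ2 asc T ?U"
    then have p: "p = (x, y)" and mem: "q \<in> P" "y < snd q" "r \<in> P" "y < snd r" "fst q < fst r" "snd q \<noteq> snd r"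
      "(snd q < snd r) = asc"
      and b: "\<And>s. s \<in> P \<Longrightarrow> y < snd s \<Longrightarrow> (cell2 (fst q) (fst r) (fst s),
              cell2 (min (snd q) (snd r)) (max (snd q) (snd r)) (snd s)) \<notin> T"
      unfolding occ2_iff by blast+
    have "(cell3 x (fst q) (fst r) (fst s), cell3 y (min (snd q) (snd r)) (max (snd q) (snd r)) (snd s)) \<notin> R"
      if "s \<in> ?G" for s
    proof (cases "s = (x, y)")
      case True
      then show ?thesis using box0[OF mem(1,5)] by simp
    next
      case False
      then have s: "s \<in> P" using that by simp
      then show ?thesis
        using box[OF mem(1) s, of "min (snd q) (snd r)" "max (snd q) (snd r)" r] mem b[OF s]
        by (simp add: less_max_iff_disj)
    qed
    then show "(p, q, r) \<in> occ3 asc R ?G"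
      using mem x[OF mem(1)] unfolding occ3_iff p fst_conv snd_conv by blast
  qed
  then have "occ3 asc R ?G = Pair (x, y) ` occ2 asc T ?U"
    by (intro set_eqI) (auto simp del: mem_Collect_eq)
  moreover have "card (Pair (x, y) ` occ2 asc T ?U) = card (occ2 asc T ?U)"
    by (rule card_image) (simp add: inj_on_def)
  ultimately show "card (occ3 asc ?R ?G) = card (occ2 asc T ?U)"
    unfolding R_def[symmetric] by simp
qed

text \<open>Boxes \<open>(0,0)\<close> and \<open>(1,0)\<close> say that the first letter is the
  lowest point left of the second. The other six say that, apart from the second letter, all points
  left of the third lie below both upper letters. Hence dropping the first letter is a bijection
  onto occurrences of two letters above the leftmost point.\<close>

lemma standard3_R'_boxes: "standard3 R'_boxes"
proof (rule standard3_if_reduces[where T = "{(0,1), (0,2), (1,1), (1,2)}"])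
  have "{(a, b). (Suc a, Suc b) \<in> S_boxes 18} = {(0,1), (0,2), (1,1), (1,2)}"
    by (auto simp: S_boxes_def)
  then show "standard2 {(0,1), (0,2), (1,1), (1,2)}"
    using standard2_S_boxes[of 18] by simp
next
  fix X Y P x y asc
  assume finP: "finite P" and P: "P \<in> diagrams X Y" and y: "y \<notin> Y" and x: "\<And>p. p \<in> P \<Longrightarrow> x < fst p"
  define T :: "(nat \<times> nat) set" where "T = {(0,1), (0,2), (1,1), (1,2)}"
  define G where "G = insert (x, y) P"
  define U where "U = {p \<in> P. y < snd p}"
  have "x \<notin> X" using P x by (fastforce simp: diagrams_def)
  then have GD: "G \<in> diagrams (insert x X) (insert y Y)"
    unfolding G_def using P y by (intro diagrams_insert) simp_all
  note G_fst = diagrams_fst_inj[OF GD] and G_snd = diagrams_snd_inj[OF GD]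
  have U_sub: "U \<subseteq> G" by (auto simp: U_def G_def)
  have xmin: "x \<le> fst s" if "s \<in> G" for s using that x[of s] by (auto simp: G_def)
  have G_U: "s \<in> U \<or> snd s \<le> y" if "s \<in> G" for s using that by (auto simp: G_def U_def)
  \<comment> \<open>This and \<open>box3\<close> turn the shadings into inequalities; points on grid
    lines, that is, the letters themselves, are treated separately.\<close>
  have box2: "(cell2 (fst q) (fst r) (fst s), cell2 lo hi (snd s)) \<notin> T \<longleftrightarrow>
      (fst s < fst r \<longrightarrow> s \<noteq> q \<longrightarrow> snd s < lo)"
    if "q \<in> G" "s \<in> G" "r \<in> G" "fst q < fst r" "lo < hi" "lo = snd q \<and> hi = snd r \<or> lo = snd r \<and> hi = snd q"
    for q r s lo hi
  proof (cases "s = q \<or> s = r")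
    case True
    then show ?thesis using that(4-6) by (auto simp: cell2_def T_def)
  next
    case False
    then have "fst s \<noteq> fst q" "fst s \<noteq> fst r" "snd s \<noteq> lo" "snd s \<noteq> hi"
      using that(6) False G_fst[OF that(2,1)] G_fst[OF that(2,3)] G_snd[OF that(2,1)] G_snd[OF that(2,3)]
      by auto
    then show ?thesis using False that(4,5) by (auto simp: cell2_def T_def)
  qed
  have box3: "(cell3 (fst p) (fst q) (fst r) (fst s), cell3 (snd p) lo hi (snd s)) \<notin> R'_boxes \<longleftrightarrow>
      (fst s < fst q \<longrightarrow> snd p \<le> snd s) \<and> (fst s < fst r \<longrightarrow> s \<noteq> q \<longrightarrow> snd s < lo)"
    if "p \<in> G" "q \<in> G" "s \<in> G" "r \<in> G" "fst p < fst q" "fst q < fst r" "snd p < lo" "lo < hi"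
      "lo = snd q \<and> hi = snd r \<or> lo = snd r \<and> hi = snd q" for p q r s lo hi
  proof (cases "s = p \<or> s = q \<or> s = r")
    case True
    then show ?thesis using that(5-9) by (auto simp: cell3_def R'_boxes_def)
  next
    case False
    then have neq: "fst s \<noteq> fst p" "fst s \<noteq> fst q" "fst s \<noteq> fst r" "snd s \<noteq> snd p" "snd s \<noteq> lo" "snd s \<noteq> hi"
      using that(9) False G_fst[OF that(3,1)] G_fst[OF that(3,2)] G_fst[OF that(3,4)]
        G_snd[OF that(3,1)] G_snd[OF that(3,2)] G_snd[OF that(3,4)]
      by auto
    consider "fst s < fst p" | "fst p < fst s" "fst s < fst q" | "fst q < fst s" "fst s < fst r" | "fst r < fst s"
      using neq by linarith
    then show ?thesis
      by cases (use neq that(5-8) False in \<open>auto simp: cell3_def R'_boxes_def\<close>)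
  qed
  have occ3: "(p, q, r) \<in> occ3 asc R'_boxes G \<longleftrightarrow>
      (q, r) \<in> occ2 asc T U \<and> p \<in> G \<and> fst p < fst q \<and> (\<forall>s\<in>G. fst s < fst q \<longrightarrow> snd p \<le> snd s)" for p q r
  proof
    assume *: "(p, q, r) \<in> occ3 asc R'_boxes G"
    then have mem: "p \<in> G" "q \<in> G" "r \<in> G" "fst p < fst q" "fst q < fst r"
      "snd p < snd q" "snd p < snd r" "snd q \<noteq> snd r" "(snd q < snd r) = asc"
      and b: "\<And>s. s \<in> G \<Longrightarrow> (cell3 (fst p) (fst q) (fst r) (fst s),
              cell3 (snd p) (min (snd q) (snd r)) (max (snd q) (snd r)) (snd s)) \<notin> R'_boxes"
      unfolding occ3_iff by blast+
    have lohi: "min (snd q) (snd r) < max (snd q) (snd r)" "snd p < min (snd q) (snd r)"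
      "min (snd q) (snd r) = snd q \<and> max (snd q) (snd r) = snd r \<or>
       min (snd q) (snd r) = snd r \<and> max (snd q) (snd r) = snd q"
      using mem(6-8) by (auto simp: min_def max_def)
    have C: "(fst s < fst q \<longrightarrow> snd p \<le> snd s) \<and> (fst s < fst r \<longrightarrow> s \<noteq> q \<longrightarrow> snd s < min (snd q) (snd r))"
      if "s \<in> G" for s
      using box3[OF mem(1,2) that mem(3-5) lohi(2,1,3)] b[OF that] by simp
    have "x < fst q" using xmin[OF mem(1)] mem(4) by simp
    \<comment> \<open>The leftmost point is left of \<open>r\<close> and different from
      \<open>q\<close>, so it is below both upper letters.\<close>
    then have "y < min (snd q) (snd r)"
      using C[of "(x, y)"] mem(5) by (auto simp: G_def)
    then have U: "q \<in> U" "r \<in> U" using G_U[OF mem(2)] G_U[OF mem(3)] by auto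
    have "(cell2 (fst q) (fst r) (fst s), cell2 (min (snd q) (snd r)) (max (snd q) (snd r)) (snd s)) \<notin> T"
      if "s \<in> U" for s
      using box2[OF mem(2) _ mem(3,5) lohi(1,3)] C[of s] that U_sub by blast
    then have "(q, r) \<in> occ2 asc T U" using U mem unfolding occ2_iff by blast
    then show "(q, r) \<in> occ2 asc T U \<and> p \<in> G \<and> fst p < fst q \<and> (\<forall>s\<in>G. fst s < fst q \<longrightarrow> snd p \<le> snd s)"
      using mem C by blast
  next
    assume *: "(q, r) \<in> occ2 asc T U \<and> p \<in> G \<and> fst p < fst q \<and> (\<forall>s\<in>G. fst s < fst q \<longrightarrow> snd p \<le> snd s)"
    then have U: "q \<in> U" "r \<in> U" and mem: "fst q < fst r" "snd q \<noteq> snd r" "(snd q < snd r) = asc"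
      "p \<in> G" "fst p < fst q"
      and b: "\<And>s. s \<in> U \<Longrightarrow> (cell2 (fst q) (fst r) (fst s),
              cell2 (min (snd q) (snd r)) (max (snd q) (snd r)) (snd s)) \<notin> T"
      and low: "\<And>s. s \<in> G \<Longrightarrow> fst s < fst q \<Longrightarrow> snd p \<le> snd s"
      unfolding occ2_iff by blast+
    have G: "q \<in> G" "r \<in> G" using U U_sub by auto
    have above: "y < min (snd q) (snd r)" using U by (simp add: U_def)
    have "x < fst q" using xmin[OF mem(4)] mem(5) by simp
    \<comment> \<open>The leftmost point competes for being the lowest point left of
      \<open>q\<close>, so \<open>p\<close> is at most as high and lies below both upper
      letters.\<close>
    then have "snd p \<le> y" using low[of "(x, y)"] by (simp add: G_def)
    then have lohi: "min (snd q) (snd r) < max (snd q) (snd r)" "snd p < min (snd q) (snd r)"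
      "min (snd q) (snd r) = snd q \<and> max (snd q) (snd r) = snd r \<or>
       min (snd q) (snd r) = snd r \<and> max (snd q) (snd r) = snd q"
      using mem(2) above by (auto simp: min_def max_def)
    \<comment> \<open>The length-two condition speaks of points above \<open>y\<close> only; every
      other point is below both letters already.\<close>
    have C: "fst s < fst r \<longrightarrow> s \<noteq> q \<longrightarrow> snd s < min (snd q) (snd r)" if "s \<in> G" for s
    proof (cases "s \<in> U")
      case True
      then show ?thesis using box2[OF G(1) that G(2) mem(1) lohi(1,3)] b[OF True] by blast
    next
      case False
      then show ?thesis using G_U[OF that] above by auto
    qed
    have "(cell3 (fst p) (fst q) (fst r) (fst s),
        cell3 (snd p) (min (snd q) (snd r)) (max (snd q) (snd r)) (snd s)) \<notin> R'_boxes" if "s \<in> G" for s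
      using box3[OF mem(4) G(1) that G(2) mem(5,1) lohi(2,1,3)] C[OF that] low[OF that] by blast
    moreover have "snd p < snd q" "snd p < snd r" using lohi(2) by simp_all
    ultimately show "(p, q, r) \<in> occ3 asc R'_boxes G"
      using G mem unfolding occ3_iff by blast
  qed
  have "bij_betw snd (occ3 asc R'_boxes G) (occ2 asc T U)"
    unfolding bij_betw_def
  proof
    show "inj_on snd (occ3 asc R'_boxes G)"
    proof (rule inj_onI)
      fix z z' assume z: "z \<in> occ3 asc R'_boxes G" "z' \<in> occ3 asc R'_boxes G" and eq: "snd z = snd z'"
      obtain p p' q r where zz: "z = (p, q, r)" "z' = (p', q, r)"
        using eq by (cases z, cases z') auto
      have "p \<in> G" "p' \<in> G" "snd p \<le> snd p'" "snd p' \<le> snd p"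
        using z unfolding zz occ3 by auto
      then have "p = p'" by (intro G_snd) auto
      then show "z = z'" using zz by simp
    qed
    show "snd ` occ3 asc R'_boxes G = occ2 asc T U"
    proof
      show "snd ` occ3 asc R'_boxes G \<subseteq> occ2 asc T U"
        by (rule image_subsetI) (auto simp: occ3)
      show "occ2 asc T U \<subseteq> snd ` occ3 asc R'_boxes G"
      proof
        fix z assume z: "z \<in> occ2 asc T U"
        obtain q r where qr: "z = (q, r)" by (cases z)
        have "q \<in> P" using z unfolding qr occ2_iff by (simp add: U_def)
        \<comment> \<open>The lost first letter is recovered as the lowest point of
          \<open>?L\<close>, which contains the leftmost point and so is nonempty.\<close>
        let ?L = "{s \<in> G. fst s < fst q}"
        have L: "finite ?L" "?L \<noteq> {}" using finP x[OF \<open>q \<in> P\<close>] by (auto simp: G_def)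
        then obtain p where p: "p \<in> ?L" "snd p = Min (snd ` ?L)"
          using Min_in[of "snd ` ?L"] by fastforce
        have "snd p \<le> snd s" if "s \<in> ?L" for s
          unfolding p(2) using L(1) that by simp
        then have "(p, q, r) \<in> occ3 asc R'_boxes G"
          unfolding occ3 using z p(1) qr by simp
        then show "z \<in> snd ` occ3 asc R'_boxes G"
          by (rule rev_image_eqI) (simp add: qr)
      qed
    qed
  qed
  from bij_betw_same_card[OF this]
  show "card (occ3 asc R'_boxes (insert (x, y) P)) =
      card (occ2 asc {(0,1), (0,2), (1,1), (1,2)} {p \<in> P. y < snd p})"
    unfolding G_def U_def T_def .
qed

section \<open>Mesh occurrences as points\<close>

definition perm_graph :: "nat \<Rightarrow> (nat \<Rightarrow> nat) \<Rightarrow> (int \<times> int) set" where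
  "perm_graph n \<pi> = (\<lambda>i. (int i, int (\<pi> i))) ` {1..n}"

lemma perm_graph_iff: "(int i, b) \<in> perm_graph n \<pi> \<longleftrightarrow> i \<in> {1..n} \<and> b = int (\<pi> i)"
  by (auto simp: perm_graph_def)

lemma perm_graph_diagrams:
  assumes "\<pi> permutes {1..n}"
  shows "perm_graph n \<pi> \<in> diagrams (int ` {1..n}) (int ` {1..n})"
proof -
  have "\<exists>!b. (a, b) \<in> perm_graph n \<pi>" if "a \<in> int ` {1..n}" for a
    using that by (auto simp: perm_graph_iff)
  moreover have "\<exists>!a. (a, b) \<in> perm_graph n \<pi>" if b: "b \<in> int ` {1..n}" for b
  proof -
    obtain v where v: "v \<in> {1..n}" "b = int v" using b by blast
    then obtain i where i: "i \<in> {1..n}" "\<pi> i = v"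
      using permutes_image[OF assms] by (metis imageE)
    have "a = int i" if "(a, b) \<in> perm_graph n \<pi>" for a
    proof -
      obtain k where "k \<in> {1..n}" "a = int k" "b = int (\<pi> k)"
        using \<open>(a, b) \<in> perm_graph n \<pi>\<close> by (auto simp: perm_graph_def)
      then show ?thesis using i v permutes_inj[OF assms] by (simp add: inj_eq)
    qed
    moreover have "(int i, b) \<in> perm_graph n \<pi>" using i v by (simp add: perm_graph_iff)
    ultimately show ?thesis by blast
  qed
  moreover have "perm_graph n \<pi> \<subseteq> int ` {1..n} \<times> int ` {1..n}"
    using permutes_in_image[OF assms] by (auto simp: perm_graph_def simp del: atLeastAtMost_iff)
  ultimately show ?thesis unfolding diagrams_def by simp
qed

lemma bij_betw_perm_graph:
  "bij_betw (perm_graph n) {\<pi>. \<pi> permutes {1..n}} (diagrams (int ` {1..n}) (int ` {1..n}))"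
  unfolding bij_betw_def
proof
  show "inj_on (perm_graph n) {\<pi>. \<pi> permutes {1..n}}"
  proof (rule inj_onI)
    fix \<pi> \<rho> assume perm: "\<pi> \<in> {\<pi>. \<pi> permutes {1..n}}" "\<rho> \<in> {\<pi>. \<pi> permutes {1..n}}"
      and eq: "perm_graph n \<pi> = perm_graph n \<rho>"
    show "\<pi> = \<rho>"
    proof
      fix i
      show "\<pi> i = \<rho> i"
      proof (cases "i \<in> {1..n}")
        case True
        then have "(int i, int (\<pi> i)) \<in> perm_graph n \<rho>" by (simp add: perm_graph_iff flip: eq)
        then show ?thesis by (simp add: perm_graph_iff)
      next
        case False
        then show ?thesis
          using perm permutes_not_in[of \<pi> "{1..n}" i] permutes_not_in[of \<rho> "{1..n}" i] by simp
      qed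
    qed
  qed
  show "perm_graph n ` {\<pi>. \<pi> permutes {1..n}} = diagrams (int ` {1..n}) (int ` {1..n})"
  proof
    show "perm_graph n ` {\<pi>. \<pi> permutes {1..n}} \<subseteq> diagrams (int ` {1..n}) (int ` {1..n})"
      using perm_graph_diagrams by auto
    show "diagrams (int ` {1..n}) (int ` {1..n}) \<subseteq> perm_graph n ` {\<pi>. \<pi> permutes {1..n}}"
    proof
      fix P assume P: "P \<in> diagrams (int ` {1..n}) (int ` {1..n})"
      have "\<exists>v\<in>{1..n}. (int i, int v) \<in> P" if "i \<in> {1..n}" for i
      proof -
        have "\<exists>!b. (int i, b) \<in> P" using P that by (simp add: diagrams_def)
        then obtain b where "(int i, b) \<in> P" by blast
        then show ?thesis using diagrams_subset[OF P] by auto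
      qed
      then obtain f where f: "\<And>i. i \<in> {1..n} \<Longrightarrow> f i \<in> {1..n} \<and> (int i, int (f i)) \<in> P" by metis
      define \<pi> where "\<pi> i = (if i \<in> {1..n} then f i else i)" for i
      have "inj_on \<pi> {1..n}"
      proof (rule inj_onI)
        fix i j assume ij: "i \<in> {1..n}" "j \<in> {1..n}" "\<pi> i = \<pi> j"
        then have "(int i, int (f i)) = (int j, int (f j))"
          using f[of i] f[of j] by (intro diagrams_snd_inj[OF P]) (auto simp: \<pi>_def)
        then show "i = j" by simp
      qed
      moreover have "\<pi> ` {1..n} \<subseteq> {1..n}" using f by (auto simp: \<pi>_def)
      ultimately have "bij_betw \<pi> {1..n} {1..n}"
        by (simp add: bij_betw_def endo_inj_surj)
      then have perm: "\<pi> permutes {1..n}"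
        by (rule bij_imp_permutes) (auto simp: \<pi>_def)
      have "P = perm_graph n \<pi>"
      proof
        show "perm_graph n \<pi> \<subseteq> P" using f by (auto simp: perm_graph_def \<pi>_def)
        show "P \<subseteq> perm_graph n \<pi>"
        proof
          fix p assume p: "p \<in> P"
          then obtain i where i: "i \<in> {1..n}" "fst p = int i" using diagrams_subset[OF P] by auto
          then have "p = (int i, int (f i))"
            using f[OF i(1)] p by (intro diagrams_fst_inj[OF P]) auto
          then show "p \<in> perm_graph n \<pi>" using i(1) by (simp add: perm_graph_iff \<pi>_def)
        qed
      qed
      then show "P \<in> perm_graph n ` {\<pi>. \<pi> permutes {1..n}}" using perm by blast
    qed
  qed
qed

section \<open>From lists of positions to triples of points\<close>

lemma cell3_sentinels:
  assumes "a \<le> 3" "i < j" "j < k" "1 \<le> m" "m \<le> n"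
  shows "(0 # [i, j, k] @ [n + 1]) ! a < m \<and> m < (0 # [i, j, k] @ [n + 1]) ! (a + 1) \<longleftrightarrow>
    cell3 (int i) (int j) (int k) (int m) = a"
proof -
  \<comment> \<open>The sentinels 0 and \<open>n + 1\<close> are never binding for \<open>m\<close>
    between 1 and \<open>n\<close>, which makes the outer intervals agree with the unbounded outer
    cells.\<close>
  have "a = 0 \<or> a = 1 \<or> a = 2 \<or> a = 3" using assms(1) by linarith
  then show ?thesis
    using assms(2-) by (elim disjE) (auto simp: cell3_def)
qed

definition index_occ3 :: "bool \<Rightarrow> (nat \<times> nat) set \<Rightarrow> nat \<Rightarrow> (nat \<Rightarrow> nat) \<Rightarrow> (nat \<times> nat \<times> nat) set" where
  "index_occ3 asc R n \<pi> = {(i, j, k). 1 \<le> i \<and> i < j \<and> j < k \<and> k \<le> n \<and> \<pi> i < \<pi> j \<and> \<pi> i < \<pi> k \<and>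
     \<pi> j \<noteq> \<pi> k \<and> (\<pi> j < \<pi> k) = asc \<and>
     (\<forall>m\<in>{1..n}. (cell3 (int i) (int j) (int k) (int m),
        cell3 (int (\<pi> i)) (int (min (\<pi> j) (\<pi> k))) (int (max (\<pi> j) (\<pi> k))) (int (\<pi> m))) \<notin> R)}"

lemma card_occ3_perm_graph:
  "card (occ3 asc R (perm_graph n \<pi>)) = card (index_occ3 asc R n \<pi>)"
proof -
  let ?g = "\<lambda>i. (int i, int (\<pi> i))"
  let ?f = "\<lambda>(i, j, k). (?g i, ?g j, ?g k)"
  have int_min_max: "min (int a) (int b) = int (min a b)" "max (int a) (int b) = int (max a b)" for a b
    by simp_all
  have mem: "(?g i, ?g j, ?g k) \<in> occ3 asc R (perm_graph n \<pi>) \<longleftrightarrow> (i, j, k) \<in> index_occ3 asc R n \<pi>" for i j k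
    unfolding occ3_iff index_occ3_def perm_graph_iff int_min_max fst_conv snd_conv
    unfolding perm_graph_def by auto
  have "occ3 asc R (perm_graph n \<pi>) = ?f ` index_occ3 asc R n \<pi>"
  proof
    show "occ3 asc R (perm_graph n \<pi>) \<subseteq> ?f ` index_occ3 asc R n \<pi>"
    proof
      fix z assume z: "z \<in> occ3 asc R (perm_graph n \<pi>)"
      obtain p q r where zz: "z = (p, q, r)" by (cases z)
      then have "p \<in> perm_graph n \<pi>" "q \<in> perm_graph n \<pi>" "r \<in> perm_graph n \<pi>"
        using z by (simp_all add: occ3_iff)
      then obtain i j k where "z = (?g i, ?g j, ?g k)" unfolding zz by (auto simp: perm_graph_def)
      then show "z \<in> ?f ` index_occ3 asc R n \<pi>"
        using z mem by (intro rev_image_eqI[of "(i, j, k)"]) simp_all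
    qed
    show "?f ` index_occ3 asc R n \<pi> \<subseteq> occ3 asc R (perm_graph n \<pi>)"
    proof (rule image_subsetI)
      fix t assume "t \<in> index_occ3 asc R n \<pi>"
      then show "?f t \<in> occ3 asc R (perm_graph n \<pi>)" using mem by (cases t) simp
    qed
  qed
  moreover have "inj_on ?f (index_occ3 asc R n \<pi>)" by (auto simp: inj_on_def)
  ultimately show ?thesis by (simp add: card_image)
qed

text \<open>The viewpoint changes from shaded boxes, each of which must be empty, to points, each of
  which has a unique cell that must be unshaded.\<close>

lemma mesh_boxes_iff:
  assumes R: "R \<subseteq> {0..3} \<times> {0..3}" and \<pi>: "\<pi> permutes {1..n}" and "i < j" "j < k" "u < v" "v < z"
  shows "(\<forall>(a, b)\<in>R. \<not> (\<exists>m\<in>{1..n}. (0 # [i, j, k] @ [n + 1]) ! a < m \<and> m < (0 # [i, j, k] @ [n + 1]) ! (a + 1) \<and>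
      (0 # [u, v, z] @ [n + 1]) ! b < \<pi> m \<and> \<pi> m < (0 # [u, v, z] @ [n + 1]) ! (b + 1))) \<longleftrightarrow>
    (\<forall>m\<in>{1..n}. (cell3 (int i) (int j) (int k) (int m), cell3 (int u) (int v) (int z) (int (\<pi> m))) \<notin> R)"
proof -
  have "(0 # [i, j, k] @ [n + 1]) ! a < m \<and> m < (0 # [i, j, k] @ [n + 1]) ! (a + 1) \<and>
      (0 # [u, v, z] @ [n + 1]) ! b < \<pi> m \<and> \<pi> m < (0 # [u, v, z] @ [n + 1]) ! (b + 1) \<longleftrightarrow>
      cell3 (int i) (int j) (int k) (int m) = a \<and> cell3 (int u) (int v) (int z) (int (\<pi> m)) = b"
    if "(a, b) \<in> R" "m \<in> {1..n}" for a b m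
  proof -
    have "a \<le> 3" "b \<le> 3" using that R by auto
    moreover have "\<pi> m \<in> {1..n}" using permutes_in_image[OF \<pi>] that(2) by blast
    ultimately show ?thesis
      using cell3_sentinels[of a i j k m n] cell3_sentinels[of b u v z "\<pi> m" n] assms(3-) that(2) by auto
  qed
  note box = this
  show ?thesis
  proof
    assume L: "\<forall>(a, b)\<in>R. \<not> (\<exists>m\<in>{1..n}. (0 # [i, j, k] @ [n + 1]) ! a < m \<and> m < (0 # [i, j, k] @ [n + 1]) ! (a + 1) \<and>
      (0 # [u, v, z] @ [n + 1]) ! b < \<pi> m \<and> \<pi> m < (0 # [u, v, z] @ [n + 1]) ! (b + 1))"
    show "\<forall>m\<in>{1..n}. (cell3 (int i) (int j) (int k) (int m), cell3 (int u) (int v) (int z) (int (\<pi> m))) \<notin> R"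
    proof (intro ballI notI)
      fix m assume m: "m \<in> {1..n}" and "(cell3 (int i) (int j) (int k) (int m), cell3 (int u) (int v) (int z) (int (\<pi> m))) \<in> R"
      then show False using L box[OF _ m] by blast
    qed
  next
    assume "\<forall>m\<in>{1..n}. (cell3 (int i) (int j) (int k) (int m), cell3 (int u) (int v) (int z) (int (\<pi> m))) \<notin> R"
    then show "\<forall>(a, b)\<in>R. \<not> (\<exists>m\<in>{1..n}. (0 # [i, j, k] @ [n + 1]) ! a < m \<and> m < (0 # [i, j, k] @ [n + 1]) ! (a + 1) \<and>
      (0 # [u, v, z] @ [n + 1]) ! b < \<pi> m \<and> \<pi> m < (0 # [u, v, z] @ [n + 1]) ! (b + 1))"
      using box by blast
  qed
qed

lemma atLeastAtMost_1_3: "{1..3::nat} = {1, 2, 3}"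
  by auto

lemma mesh_occurrences_3:
  assumes R: "R \<subseteq> {0..3} \<times> {0..3}" and \<pi>: "\<pi> permutes {1..n}"
  shows "mesh_occurrences (3, if asc then id else transpose 2 3, R) n \<pi> =
    (\<lambda>(i, j, k). [i, j, k]) ` index_occ3 asc R n \<pi>"
proof -
  have list: "[i, j, k] \<in> mesh_occurrences (3, if asc then id else transpose 2 3, R) n \<pi> \<longleftrightarrow>
      (i, j, k) \<in> index_occ3 asc R n \<pi>" for i j k
  proof (cases "1 \<le> i \<and> i < j \<and> j < k \<and> k \<le> n \<and> \<pi> i < \<pi> j \<and> \<pi> i < \<pi> k \<and> \<pi> j \<noteq> \<pi> k \<and> (\<pi> j < \<pi> k) = asc")
    case True
    \<comment> \<open>In 123 and in 132 the first letter is the smallest, so sorting affects the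
      last two only.\<close>
    have sort: "sort (map \<pi> [i, j, k]) = [\<pi> i, min (\<pi> j) (\<pi> k), max (\<pi> j) (\<pi> k)]"
      using True by (auto simp: min_def max_def)
    have "\<forall>a\<in>{1..3}. \<forall>b\<in>{1..3}. \<pi> ((0 # [i, j, k] @ [n + 1]) ! a) < \<pi> ((0 # [i, j, k] @ [n + 1]) ! b) \<longleftrightarrow>
        (if asc then id else transpose 2 3) a < (if asc then id else transpose 2 3) b"
      using True unfolding atLeastAtMost_1_3 by (cases asc) (auto simp: transpose_def)
    moreover have "(\<forall>(a, b)\<in>R. \<not> (\<exists>m\<in>{1..n}. (0 # [i, j, k] @ [n + 1]) ! a < m \<and> m < (0 # [i, j, k] @ [n + 1]) ! (a + 1) \<and>
      (0 # [\<pi> i, min (\<pi> j) (\<pi> k), max (\<pi> j) (\<pi> k)] @ [n + 1]) ! b < \<pi> m \<and>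
      \<pi> m < (0 # [\<pi> i, min (\<pi> j) (\<pi> k), max (\<pi> j) (\<pi> k)] @ [n + 1]) ! (b + 1))) \<longleftrightarrow>
      (\<forall>m\<in>{1..n}. (cell3 (int i) (int j) (int k) (int m),
        cell3 (int (\<pi> i)) (int (min (\<pi> j) (\<pi> k))) (int (max (\<pi> j) (\<pi> k))) (int (\<pi> m))) \<notin> R)"
      by (rule mesh_boxes_iff[OF R \<pi>]) (use True in auto)
    ultimately show ?thesis
      unfolding mesh_occurrences_def prod.case mem_Collect_eq Let_def sort index_occ3_def
      using True by simp
  next
    case False
    have "\<not> ([i, j, k] \<in> mesh_occurrences (3, if asc then id else transpose 2 3, R) n \<pi>)"
    proof
      assume "[i, j, k] \<in> mesh_occurrences (3, if asc then id else transpose 2 3, R) n \<pi>"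
      then have "i < j" "j < k" "i \<in> {1..n}" "k \<in> {1..n}"
        and "\<forall>a\<in>{1..3}. \<forall>b\<in>{1..3}. \<pi> ((0 # [i, j, k] @ [n + 1]) ! a) < \<pi> ((0 # [i, j, k] @ [n + 1]) ! b) \<longleftrightarrow>
        (if asc then id else transpose 2 3) a < (if asc then id else transpose 2 3) b"
        unfolding mesh_occurrences_def prod.case mem_Collect_eq Let_def by simp_all
      then show False
        using False unfolding atLeastAtMost_1_3 by (cases asc) (auto simp: transpose_def)
    qed
    then show ?thesis using False by (auto simp: index_occ3_def)
  qed
  show ?thesis
  proof
    show "mesh_occurrences (3, if asc then id else transpose 2 3, R) n \<pi> \<subseteq>
        (\<lambda>(i, j, k). [i, j, k]) ` index_occ3 asc R n \<pi>"
    proof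
      fix ps assume ps: "ps \<in> mesh_occurrences (3, if asc then id else transpose 2 3, R) n \<pi>"
      then have "length ps = 3" by (simp add: mesh_occurrences_def)
      then obtain i j k where "ps = [i, j, k]" by (auto simp: numeral_3_eq_3 length_Suc_conv)
      then show "ps \<in> (\<lambda>(i, j, k). [i, j, k]) ` index_occ3 asc R n \<pi>"
        using ps list by (intro rev_image_eqI[of "(i, j, k)"]) simp_all
    qed
    show "(\<lambda>(i, j, k). [i, j, k]) ` index_occ3 asc R n \<pi> \<subseteq>
        mesh_occurrences (3, if asc then id else transpose 2 3, R) n \<pi>"
    proof (rule image_subsetI)
      fix t assume "t \<in> index_occ3 asc R n \<pi>"
      then show "(case t of (i, j, k) \<Rightarrow> [i, j, k]) \<in> mesh_occurrences (3, if asc then id else transpose 2 3, R) n \<pi>"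
        using list by (cases t) simp
    qed
  qed
qed

lemma card_mesh_occurrences:
  assumes "R \<subseteq> {0..3} \<times> {0..3}" "\<pi> permutes {1..n}"
  shows "card (mesh_occurrences (mesh123 R) n \<pi>) = card (occ3 True R (perm_graph n \<pi>))"
    and "card (mesh_occurrences (mesh132 R) n \<pi>) = card (occ3 False R (perm_graph n \<pi>))"
proof -
  have "card ((\<lambda>(i, j, k). [i, j, k]) ` index_occ3 asc R n \<pi>) = card (occ3 asc R (perm_graph n \<pi>))" for asc
    unfolding card_occ3_perm_graph by (rule card_image) (auto simp: inj_on_def)
  then show "card (mesh_occurrences (mesh123 R) n \<pi>) = card (occ3 True R (perm_graph n \<pi>))"
    "card (mesh_occurrences (mesh132 R) n \<pi>) = card (occ3 False R (perm_graph n \<pi>))"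
    using mesh_occurrences_3[OF assms, of True] mesh_occurrences_3[OF assms, of False]
    by (simp_all add: mesh123_def mesh132_def)
qed

section \<open>Joint distributions of the shadings\<close>

lemma joint_distribution_standard3:
  assumes "standard3 R" and R: "R \<subseteq> {0..3} \<times> {0..3}"
  shows "joint_distribution (mesh123 R) (mesh132 R) n k l =
    total_sum n (\<lambda>a b. of_bool (a = k \<and> b = l))"
proof -
  \<comment> \<open>This indicator weight turns the weighted sum into the number of permutations
    with the prescribed counts.\<close>
  let ?w = "\<lambda>a b. of_bool (a = k \<and> b = l) :: nat"
  let ?Q = "\<lambda>\<pi>. card (mesh_occurrences (mesh123 R) n \<pi>) = k \<and> card (mesh_occurrences (mesh132 R) n \<pi>) = l"
  have "joint_distribution (mesh123 R) (mesh132 R) n k l =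
      (\<Sum>\<pi>\<in>{\<pi>. \<pi> permutes {1..n}}. of_bool (?Q \<pi>))"
  proof -
    have "{\<pi>. \<pi> permutes {1..n} \<and> ?Q \<pi>} = {\<pi>. \<pi> permutes {1..n}} \<inter> {\<pi>. ?Q \<pi>}" by auto
    then show ?thesis
      using sum_of_bool_eq[of "{\<pi>. \<pi> permutes {1..n}}" ?Q] finite_permutations[of "{1..n}"]
      by (simp add: joint_distribution_def)
  qed
  also have "\<dots> = (\<Sum>\<pi>\<in>{\<pi>. \<pi> permutes {1..n}}. stat3 ?w R (perm_graph n \<pi>))"
    by (rule sum.cong[OF refl]) (simp add: stat3_def card_mesh_occurrences[OF R])
  also have "\<dots> = (\<Sum>P\<in>diagrams (int ` {1..n}) (int ` {1..n}). stat3 ?w R P)"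
    by (rule sum.reindex_bij_betw[OF bij_betw_perm_graph])
  also have "\<dots> = total_sum (card (int ` {1..n})) ?w"
    using assms(1) by (simp add: standard3_def)
  also have "card (int ` {1..n}) = n"
    by (simp add: card_image)
  finally show ?thesis .
qed

lemma standard3_boxes:
  "standard3 R_boxes"
  "9 \<le> j \<Longrightarrow> j \<le> 18 \<Longrightarrow> standard3 (X_boxes j)"
  "9 \<le> j \<Longrightarrow> j \<le> 18 \<Longrightarrow> standard3 (Y_boxes j)"
proof -
  \<comment> \<open>\<open>R_boxes\<close> and \<open>Y_boxes j\<close> are the transposes of
    \<open>R'_boxes\<close> and \<open>X_boxes j\<close>, so inversion carries the results
    over.\<close>
  have "R_boxes = prod.swap ` R'_boxes" by (auto simp: R_boxes_def R'_boxes_def)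
  then show "standard3 R_boxes" using standard3_swap[OF standard3_R'_boxes] by simp
  show X: "standard3 (X_boxes j)" if j: "9 \<le> j" "j \<le> 18"
  proof -
    have S: "(0, b) \<notin> S_boxes j" "(a, 0) \<notin> S_boxes j" for a b
      by (auto simp: S_boxes_def)
    have "X_boxes j = {(0,0), (0,1), (0,2), (0,3)} \<union>
        {(Suc a, Suc b) | a b. (a, b) \<in> {(a, b). (Suc a, Suc b) \<in> S_boxes j}}"
    proof -
      have "p \<in> {(Suc a, Suc b) | a b. (a, b) \<in> {(a, b). (Suc a, Suc b) \<in> S_boxes j}}" if "p \<in> S_boxes j" for p
      proof -
        obtain c d where "p = (c, d)" by (cases p)
        then show ?thesis using that S by (cases c; cases d) auto
      qed
      then show ?thesis by (auto simp: X_boxes_def)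
    qed
    moreover have "{(a, b). (Suc a, Suc b) \<in> S_boxes j} \<subseteq> {0..2} \<times> {0..2}"
      by (auto simp: S_boxes_def split: if_splits)
    ultimately show ?thesis
      using standard3_X_boxes[OF standard2_S_boxes[OF j]] by simp
  qed
  have "Y_boxes j = prod.swap ` X_boxes j" by (auto simp: Y_boxes_def)
  then show "standard3 (Y_boxes j)" if "9 \<le> j" "j \<le> 18"
    using standard3_swap[OF X[OF that]] by simp
qed

theorem theorem5p6:
  shows "mesh123 R_boxes \<sim>\<^sub>j\<^sub>d mesh132 R_boxes
    \<and> mesh123 R'_boxes \<sim>\<^sub>j\<^sub>d mesh132 R'_boxes
    \<and> (\<forall>P\<in>{R_boxes, R'_boxes}. \<forall>Q\<in>X_boxes ` {9..18} \<union> Y_boxes ` {9..18}.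
         same_joint_distribution (mesh123 P, mesh132 P) (mesh123 Q, mesh132 Q))"
proof -
  \<comment> \<open>All shadings share one formula; its symmetry gives the first two claims, and its
    independence of the shading gives the third.\<close>
  have total: "joint_distribution (mesh123 P) (mesh132 P) n k l = total_sum n (\<lambda>a b. of_bool (a = k \<and> b = l))"
    if "P \<in> {R_boxes, R'_boxes} \<union> (X_boxes ` {9..18} \<union> Y_boxes ` {9..18})" for P n k l
  proof (rule joint_distribution_standard3)
    show "standard3 P" using that standard3_boxes standard3_R'_boxes by auto
    show "P \<subseteq> {0..3} \<times> {0..3}" using that boxes_in_grid by blast
  qed
  have "mesh123 P \<sim>\<^sub>j\<^sub>d mesh132 P" if "P \<in> {R_boxes, R'_boxes}" for P
  proof -
    have P: "P \<in> {R_boxes, R'_boxes} \<union> (X_boxes ` {9..18} \<union> Y_boxes ` {9..18})"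
      using that by blast
    have "joint_distribution (mesh123 P) (mesh132 P) n k l = joint_distribution (mesh123 P) (mesh132 P) n l k"
      for n k l
      unfolding total[OF P] using total_sum_commute[of n "\<lambda>a b. of_bool (a = l \<and> b = k)"]
      by (simp add: conj_commute)
    then show ?thesis by (simp add: jointly_equidistributed_def)
  qed
  moreover have "same_joint_distribution (mesh123 P, mesh132 P) (mesh123 Q, mesh132 Q)"
    if "P \<in> {R_boxes, R'_boxes}" "Q \<in> X_boxes ` {9..18} \<union> Y_boxes ` {9..18}" for P Q
  proof -
    have "P \<in> {R_boxes, R'_boxes} \<union> (X_boxes ` {9..18} \<union> Y_boxes ` {9..18})"
      "Q \<in> {R_boxes, R'_boxes} \<union> (X_boxes ` {9..18} \<union> Y_boxes ` {9..18})"
      using that by blast+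
    then show ?thesis
      unfolding same_joint_distribution_def fst_conv snd_conv by (intro allI) (simp only: total)
  qed
  ultimately show ?thesis by simp
qed

end
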